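(* Let $f(\cdot;i):\mathbb{R}^d\to\mathbb{R}$, $i\in[n]$, be convex and $L$-smooth with a common constant $L>0$, let $F=\frac1n\sum_{i=1}^n f(\cdot;i)$ have a nonempty set of minimizers, let $w_*$ be a minimizer of $F$, and let $\sigma^2:=\frac1n\sum_{i=1}^n\|\nabla f(w_*;i)\|^2$. Fix the number of epochs $T\ge1$, $0\le\beta<1$, and $\rho>0$ such that $\alpha:=\rho^{1/T}\in(0,1)$. Run the SMG algorithm with momentum parameter $\beta$, the randomized reshuffling strategy, and the epoch learning rate $\eta_t:=\eta_0\alpha^t=\frac{\gamma n^{1/3}}{T^{1/3}}\alpha^t$, for some $\gamma>0$ such that $\frac{\gamma\alpha n^{1/3}}{T^{1/3}}\le\frac{1}{2L\sqrt{1+\alpha\beta}}$. Then the output $\hat w_T$ satisfies $$\mathbb{E}\left[F(\hat w_T)-F(w_* )\right]\le\frac{1}{n^{1/3}T^{2/3}}\left(\frac{\mathbb{E}\left[\|\tilde w_0-w_*\|^2\right]}{2(1-\beta)\gamma\rho}+\frac{4L\sigma^2(1+\alpha\beta)\gamma^2}{6(1-\beta)\rho}\right).$$ Consequently, the convergence rate of the algorithm is $\mathcal{O}\left(\frac{1}{n^{1/3}T^{2/3}}\right)$.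
   Context: $[n]:=\{1,\dots,n\}$. $L$-smooth means $\|\nabla f(w;i)-\nabla f(w';i)\|\le L\|w-w'\|$ for all $w,w'\in\mathbb{R}^d$ and all $i\in[n]$. SMG (Shuffling Momentum Gradient) algorithm: choose $\tilde w_0\in\mathbb{R}^d$ and set $\tilde m_0:=\mathbf 0$. For $t=1,\dots,T$: set $w_0^{(t)}:=\tilde w_{t-1}$, $m_0^{(t)}:=\tilde m_{t-1}$, $v_0^{(t)}:=\mathbf 0$; generate a permutation $\pi^{(t)}$ of $[n]$; for $i=0,\dots,n-1$ set $g_i^{(t)}:=\nabla f(w_i^{(t)};\pi^{(t)}(i+1))$, $m_{i+1}^{(t)}:=\beta m_0^{(t)}+(1-\beta)g_i^{(t)}$, $v_{i+1}^{(t)}:=v_i^{(t)}+\frac1n g_i^{(t)}$, $w_{i+1}^{(t)}:=w_i^{(t)}-\frac{\eta_t}{n}m_{i+1}^{(t)}$; then set $\tilde w_t:=w_n^{(t)}$, $\tilde m_t:=v_n^{(t)}$. Output: $\hat w_T\in\{\tilde w_0,\dots,\tilde w_{T-1}\}$ is chosen at random with probability $\mathbb{P}[\hat w_T=\tilde w_{t-1}]=\eta_t/\sum_{s=1}^T\eta_s$ for $t=1,\dots,T$. Randomized reshuffling: at each epoch $t$, $\pi^{(t)}$ is drawn uniformly at random from all permutations of $[n]$, independently of the previous epochs. $\mathbb{E}$ is the total expectation. *)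

theory Defs
  imports "HOL-Probability.Probability"
begin

definition grad :: "('v::real_inner \<Rightarrow> real) \<Rightarrow> 'v \<Rightarrow> 'v" where
  "grad f w = (THE g. GDERIV f w :> g)"

definition L_smooth :: "real \<Rightarrow> ('v::real_inner \<Rightarrow> real) \<Rightarrow> bool" where
  "L_smooth L f \<longleftrightarrow>
     (\<forall>w. \<exists>g. GDERIV f w :> g) \<and>
     (\<forall>w w'. norm (grad f w - grad f w') \<le> L * norm (w - w'))"

definition avg_objective :: "nat \<Rightarrow> (nat \<Rightarrow> 'v \<Rightarrow> real) \<Rightarrow> 'v \<Rightarrow> real" where
  "avg_objective n f w = (\<Sum>i\<in>{1..n}. f i w) / real n"

definition grad_variance :: "nat \<Rightarrow> (nat \<Rightarrow> 'v::real_inner \<Rightarrow> real) \<Rightarrow> 'v \<Rightarrow> real" where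
  "grad_variance n f w = (\<Sum>i\<in>{1..n}. (norm (grad (f i) w))\<^sup>2) / real n"

definition lr_alpha :: "real \<Rightarrow> nat \<Rightarrow> real" where
  "lr_alpha \<rho> T = \<rho> powr (1 / real T)"

definition lr :: "real \<Rightarrow> real \<Rightarrow> nat \<Rightarrow> nat \<Rightarrow> nat \<Rightarrow> real" where
  "lr \<gamma> \<rho> n T t =
     \<gamma> * real n powr (1/3) / real T powr (1/3) * lr_alpha \<rho> T ^ t"

text \<open>
  The inner loop of one epoch: after \<open>i\<close> steps the state is \<open>(w\<^sub>i, m\<^sub>i, v\<^sub>i)\<close>.
  As in the algorithm, the momentum step always uses \<open>m0\<close>, the momentum
  at the start of the epoch, and not the most recent \<open>m\<^sub>i\<close>.
\<close>

primrec smg_inner ::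
  "(nat \<Rightarrow> 'v \<Rightarrow> real) \<Rightarrow> nat \<Rightarrow> real \<Rightarrow> real \<Rightarrow> (nat \<Rightarrow> nat) \<Rightarrow> 'v \<Rightarrow> 'v \<Rightarrow> nat
     \<Rightarrow> 'v::real_inner \<times> 'v \<times> 'v" where
  "smg_inner f n \<beta> \<eta> p w0 m0 0 = (w0, m0, 0)"
| "smg_inner f n \<beta> \<eta> p w0 m0 (Suc i) =
     (let (w, m, v) = smg_inner f n \<beta> \<eta> p w0 m0 i;
          g = grad (f (p (i + 1))) w;
          m' = \<beta> *\<^sub>R m0 + (1 - \<beta>) *\<^sub>R g;
          v' = v + (1 / real n) *\<^sub>R g;
          w' = w - (\<eta> / real n) *\<^sub>R m'
      in (w', m', v'))"

text \<open>
  After \<open>t\<close> epochs the state is \<open>(w\<^sub>t, m\<^sub>t)\<close>, the two quantities with a tilde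
  in the usual presentation; \<open>\<pi> t\<close> and \<open>\<eta> t\<close> belong to epoch \<open>t \<ge> 1\<close>.
\<close>

primrec smg ::
  "(nat \<Rightarrow> 'v \<Rightarrow> real) \<Rightarrow> nat \<Rightarrow> real \<Rightarrow> (nat \<Rightarrow> real) \<Rightarrow> (nat \<Rightarrow> nat \<Rightarrow> nat) \<Rightarrow> 'v \<Rightarrow> nat
     \<Rightarrow> 'v::real_inner \<times> 'v" where
  "smg f n \<beta> \<eta> \<pi> w0 0 = (w0, 0)"
| "smg f n \<beta> \<eta> \<pi> w0 (Suc t) =
     (let (w, m) = smg f n \<beta> \<eta> \<pi> w0 t;
          (w', _, v') = smg_inner f n \<beta> (\<eta> (Suc t)) (\<pi> (Suc t)) w m n
      in (w', v'))"

definition smg_iterate ::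
  "(nat \<Rightarrow> 'v \<Rightarrow> real) \<Rightarrow> nat \<Rightarrow> real \<Rightarrow> (nat \<Rightarrow> real) \<Rightarrow> (nat \<Rightarrow> nat \<Rightarrow> nat) \<Rightarrow> 'v \<Rightarrow> nat
     \<Rightarrow> 'v::real_inner" where
  "smg_iterate f n \<beta> \<eta> \<pi> w0 t = fst (smg f n \<beta> \<eta> \<pi> w0 t)"

abbreviation perms :: "nat \<Rightarrow> (nat \<Rightarrow> nat) set" where
  "perms n \<equiv> {p. p permutes {1..n}}"

text \<open>
  Independence of two random variables whose values may have different types;
  the library's \<open>indep_var\<close> needs equal types.
\<close>

definition (in prob_space) indep_rvs ::
  "'b measure \<Rightarrow> ('a \<Rightarrow> 'b) \<Rightarrow> 'c measure \<Rightarrow> ('a \<Rightarrow> 'c) \<Rightarrow> bool" where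
  "indep_rvs N X K Y \<longleftrightarrow>
     random_variable N X \<and> random_variable K Y \<and>
     indep_set (sets (vimage_algebra (space M) X N)) (sets (vimage_algebra (space M) Y K))"

text \<open>The information available before epoch \<open>t\<close>: the starting point and the earlier permutations.\<close>

definition history ::
  "('s \<Rightarrow> 'v) \<Rightarrow> (nat \<Rightarrow> 's \<Rightarrow> nat \<Rightarrow> nat) \<Rightarrow> nat \<Rightarrow> 's \<Rightarrow> 'v \<times> (nat \<Rightarrow> nat \<Rightarrow> nat)" where
  "history w0 \<pi> t \<omega> = (w0 \<omega>, \<lambda>s\<in>{1..<t}. \<pi> s \<omega>)"

definition history_space ::
  "nat \<Rightarrow> nat \<Rightarrow> ('v::topological_space \<times> (nat \<Rightarrow> nat \<Rightarrow> nat)) measure" where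
  "history_space n t = borel \<Otimes>\<^sub>M (\<Pi>\<^sub>M s\<in>{1..<t}. count_space (perms n))"

text \<open>
  The starting point \<open>w0\<close> may be random (a deterministic one is a constant function).
  The random index \<open>\<tau>\<close> selects the output: the algorithm returns iterate \<open>\<tau> - 1\<close>.
\<close>

locale smg_rr = prob_space M
  for M :: "'s measure" +
  fixes f :: "nat \<Rightarrow> real^'d \<Rightarrow> real"
    and wstar :: "real^'d"
    and n T :: nat
    and L \<beta> \<gamma> \<rho> :: real
    and w0 :: "'s \<Rightarrow> real^'d"
    and \<pi> :: "nat \<Rightarrow> 's \<Rightarrow> nat \<Rightarrow> nat"
    and \<tau> :: "'s \<Rightarrow> nat"
  assumes n_ge_1: "1 \<le> n"
    and T_ge_1: "1 \<le> T"
    and L_pos: "0 < L"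
    and beta: "0 \<le> \<beta>" "\<beta> < 1"
    and gamma_pos: "0 < \<gamma>"
    and rho_pos: "0 < \<rho>"
    and alpha: "lr_alpha \<rho> T \<in> {0<..<1}"
    and convex: "\<And>i. i \<in> {1..n} \<Longrightarrow> convex_on UNIV (f i)"
    and smooth: "\<And>i. i \<in> {1..n} \<Longrightarrow> L_smooth L (f i)"
    and minimizer: "\<And>w. avg_objective n f wstar \<le> avg_objective n f w"
    and lr_bound:
      "\<gamma> * lr_alpha \<rho> T * real n powr (1/3) / real T powr (1/3)
         \<le> 1 / (2 * L * sqrt (1 + lr_alpha \<rho> T * \<beta>))"
    and w0_measurable: "random_variable borel w0"
    and w0_square_integrable: "integrable M (\<lambda>\<omega>. (norm (w0 \<omega> - wstar))\<^sup>2)"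
    and perm_measurable:
      "\<And>t. t \<in> {1..T} \<Longrightarrow> random_variable (count_space (perms n)) (\<pi> t)"
    and perm_uniform:
      "\<And>t. t \<in> {1..T} \<Longrightarrow>
         distr M (count_space (perms n)) (\<pi> t) = uniform_count_measure (perms n)"
    and perm_indep:
      "\<And>t. t \<in> {1..T} \<Longrightarrow>
         indep_rvs (count_space (perms n)) (\<pi> t) (history_space n t) (history w0 \<pi> t)"
    and index_measurable: "random_variable (count_space {1..T}) \<tau>"
    and index_prob:
      "\<And>t. t \<in> {1..T} \<Longrightarrow>
         prob {\<omega> \<in> space M. \<tau> \<omega> = t} = lr \<gamma> \<rho> n T t / (\<Sum>s\<in>{1..T}. lr \<gamma> \<rho> n T s)"
    and index_indep:
      "indep_rvs (count_space {1..T}) \<tau> (history_space n (Suc T)) (history w0 \<pi> (Suc T))"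

definition smg_output ::
  "(nat \<Rightarrow> real^'d \<Rightarrow> real) \<Rightarrow> nat \<Rightarrow> nat \<Rightarrow> real \<Rightarrow> real \<Rightarrow> real \<Rightarrow>
   ('s \<Rightarrow> real^'d) \<Rightarrow> (nat \<Rightarrow> 's \<Rightarrow> nat \<Rightarrow> nat) \<Rightarrow> ('s \<Rightarrow> nat) \<Rightarrow> 's \<Rightarrow> real^'d" where
  "smg_output f n T \<beta> \<gamma> \<rho> w0 \<pi> \<tau> \<omega> =
     smg_iterate f n \<beta> (lr \<gamma> \<rho> n T) (\<lambda>t. \<pi> t \<omega>) (w0 \<omega>) (\<tau> \<omega> - 1)"

definition smg_gap ::
  "(nat \<Rightarrow> real^'d \<Rightarrow> real) \<Rightarrow> real^'d \<Rightarrow> nat \<Rightarrow> nat \<Rightarrow> real \<Rightarrow> real \<Rightarrow> real \<Rightarrow>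
   ('s \<Rightarrow> real^'d) \<Rightarrow> (nat \<Rightarrow> 's \<Rightarrow> nat \<Rightarrow> nat) \<Rightarrow> ('s \<Rightarrow> nat) \<Rightarrow> 's \<Rightarrow> real" where
  "smg_gap f wstar n T \<beta> \<gamma> \<rho> w0 \<pi> \<tau> \<omega> =
     avg_objective n f (smg_output f n T \<beta> \<gamma> \<rho> w0 \<pi> \<tau> \<omega>) - avg_objective n f wstar"

end

theory Submission
  imports Defs
begin

text \<open>
  The proof is a potential argument that holds for every sample path, followed by one
  computation with a uniform random permutation.

  Write \<open>q = \<alpha>\<beta>\<close>, \<open>c = 1 - \<beta> + q\<close>, and let \<open>u\<^sub>t\<close> be \<open>\<eta>\<^sub>t\<close> times the average of the
  gradients seen in epoch \<open>t\<close>, with \<open>u\<^sub>0 = 0\<close>. Since \<open>\<eta>\<^sub>t = \<alpha>\<eta>\<^bsub>t-1\<^esub>\<close>, an epoch moves the iterate by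
  \<open>-(1 - \<beta>)u\<^sub>t - q u\<^bsub>t-1\<^esub>\<close>, so that \<open>z\<^sub>t = w\<^sub>t - q u\<^sub>t\<close> satisfies \<open>z\<^sub>t = z\<^bsub>t-1\<^esub> - c u\<^sub>t\<close>: in the variable
  \<open>z\<close> the momentum has disappeared. Expanding \<open>|z\<^sub>t - w\<^sub>*|\<^sup>2\<close> and using convexity as in
  plain gradient descent, the gap \<open>F(w\<^bsub>t-1\<^esub>) - F(w\<^sub>*)\<close> is controlled by the decrease of
  \<open>|z\<^sub>t - w\<^sub>*|\<^sup>2/(2c)\<close> and three error terms: the squares \<open>|u\<^sub>t|\<^sup>2\<close>, the cross term
  \<open>q \<langle>u\<^sub>t, u\<^bsub>t-1\<^esub>\<rangle>\<close>, and the drift of the inner iterates away from \<open>w\<^bsub>t-1\<^esub>\<close>.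

  The first two are bounded by the deviation \<open>G\<close> of this epoch and the one before,
  \<open>G\<close> being the mean of \<open>|g\<^sub>i - h\<^sub>i|\<^sup>2\<close>, where \<open>g\<^sub>i\<close> is the gradient used in step \<open>i\<close> and \<open>h\<^sub>i\<close> the gradient of the same component at \<open>w\<^sub>*\<close>; the drift is
  bounded by \<open>G\<close>, by \<open>|u\<^bsub>t-1\<^esub>|\<^sup>2\<close>, and by the partial sums of the \<open>h\<^sub>i\<close>. The terms in \<open>|u\<^bsub>t-1\<^esub>|\<^sup>2\<close> are
  carried over from the previous epoch by adding a multiple of \<open>|u\<^sub>t|\<^sup>2\<close> to the potential. Cocoercivity of the
  gradients produces \<open>-\<eta>G/(2L)\<close> on the right-hand side, which alone does not suffice when
  \<open>\<alpha>\<beta>\<close> is close to 1. The remedy is to give up the fraction \<open>q\<close> of the gap: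
  \<open>G\<close> is also at most \<open>4L(F(w) - F(w\<^sub>*))\<close> plus \<open>2L\<^sup>2\<close> times the mean squared drift, so that
  \<open>q\<eta>(F(w) - F(w\<^sub>*))\<close> pays for a further \<open>q\<eta>G/(4L)\<close>. The claimed bound has room for this,
  because \<open>1 - \<beta> \<le> c(1 - q)\<close>. The step-size condition then makes all multiples of \<open>G\<close> cancel
  (\<open>epoch_coefficient_le\<close>, \<open>epoch_decrease\<close>), and what remains of each epoch is
  a multiple of \<open>L\<eta>\<^sub>t\<^sup>3\<close> times the mean squared norm of the partial sums of the \<open>h\<^sub>i/n\<close>.

  The \<open>h\<^sub>i\<close> do not depend on the iterates and sum to zero over an epoch, hence the uniform law of
  \<open>\<pi>\<^sub>t\<close> alone determines the expected square of a partial sum. Samples drawn without replacement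
  from a centred population are negatively correlated, so this expectation is at most \<open>i\<sigma>\<^sup>2\<close>
  for \<open>i\<close> terms (\<open>sum_perms_partial_sum_sq_le\<close>), which gives each epoch an error of order
  \<open>L\<eta>\<^sub>t\<^sup>3\<sigma>\<^sup>2/n\<close>. Summing over the epochs, \<open>\<eta>\<^sub>t\<^sup>3 \<le> \<gamma>\<^sup>3n/T\<close> bounds the
  total error by a multiple of \<open>L\<gamma>\<^sup>3\<sigma>\<^sup>2\<close>, while \<open>\<Sum>\<eta>\<^sub>t\<close> is at least
  \<open>T\<eta>\<^sub>T = \<rho>\<gamma>n\<^bsup>1/3\<^esup>T\<^bsup>2/3\<^esup>\<close>. Independence of the output index from the run turns the weighted
  average of the expected gaps into the expected gap of the output.
\<close>

section \<open>Convex functions with Lipschitz gradient\<close>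

definition bregman :: "('v::real_inner \<Rightarrow> real) \<Rightarrow> 'v \<Rightarrow> 'v \<Rightarrow> real" where
  "bregman f y x = f y - f x - inner (grad f x) (y - x)"

lemma grad_unique:
  assumes "GDERIV f w :> g"
  shows "grad f w = g"
  unfolding grad_def
proof (rule the_equality)
  fix g' assume "GDERIV f w :> g'"
  then have "(\<lambda>h. inner h g') = (\<lambda>h. inner h g)"
    using assms unfolding gderiv_def by (rule has_derivative_unique)
  then have "inner (g' - g) g' = inner (g' - g) g" by meson
  then have "inner (g' - g) (g' - g) = 0"
    by (simp only: inner_diff_right diff_self)
  then show "g' = g" by simp
qed (fact assms)

lemma L_smooth_GDERIV: "L_smooth L f \<Longrightarrow> GDERIV f w :> grad f w"
  using grad_unique unfolding L_smooth_def by metis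

lemma L_smooth_lipschitz: "L_smooth L f \<Longrightarrow> norm (grad f x - grad f y) \<le> L * norm (x - y)"
  by (simp add: L_smooth_def)

lemma L_smooth_continuous_grad: "L_smooth L f \<Longrightarrow> continuous_on UNIV (grad f)"
proof -
  assume L: "L_smooth L f"
  have "(max L 0)-lipschitz_on UNIV (grad f)"
  proof (rule lipschitz_onI)
    fix x y
    have "norm (grad f x - grad f y) \<le> L * norm (x - y)" using L by (rule L_smooth_lipschitz)
    also have "\<dots> \<le> max L 0 * norm (x - y)" by (intro mult_right_mono) auto
    finally show "dist (grad f x) (grad f y) \<le> max L 0 * dist x y" by (simp add: dist_norm)
  qed simp
  then show ?thesis by (rule lipschitz_on_continuous_on)
qed

lemma L_smooth_continuous: "L_smooth L f \<Longrightarrow> continuous_on UNIV f"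
  using L_smooth_GDERIV[of L f] unfolding gderiv_def
  by (meson continuous_at_imp_continuous_on has_derivative_continuous)

lemma L_smooth_deriv_along_line:
  assumes "L_smooth L f"
  shows "((\<lambda>t. f (x + t *\<^sub>R d)) has_real_derivative inner (grad f (x + t *\<^sub>R d)) d) (at t)"
proof -
  have "(f has_derivative (\<lambda>h. inner h (grad f (x + t *\<^sub>R d)))) (at (x + t *\<^sub>R d))"
    using L_smooth_GDERIV[OF assms] unfolding gderiv_def .
  moreover have "((\<lambda>t. x + t *\<^sub>R d) has_derivative (\<lambda>h. h *\<^sub>R d)) (at t)"
    by (auto intro!: derivative_eq_intros)
  ultimately have "((\<lambda>t. f (x + t *\<^sub>R d)) has_derivative
      (\<lambda>h. inner (h *\<^sub>R d) (grad f (x + t *\<^sub>R d)))) (at t)"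
    by (rule has_derivative_compose[rotated])
  moreover have "(\<lambda>h. inner (h *\<^sub>R d) (grad f (x + t *\<^sub>R d))) = (*) (inner (grad f (x + t *\<^sub>R d)) d)"
    by (simp add: fun_eq_iff inner_commute)
  ultimately show ?thesis
    by (simp only: has_field_derivative_def)
qed

text \<open>
  A convex function of one variable lies above its tangents; apply this along the line from \<open>x\<close> to \<open>y\<close>.
\<close>

lemma bregman_nonneg:
  assumes "L_smooth L f" "convex_on UNIV f"
  shows "0 \<le> bregman f y x"
proof -
  let ?h = "\<lambda>t. f (x + t *\<^sub>R (y - x))"
  have "convex_on UNIV ?h"
  proof (rule convex_onI)
    fix t a b :: real assume t: "0 < t" "t < 1"
    have "x + ((1 - t) *\<^sub>R a + t *\<^sub>R b) *\<^sub>R (y - x)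
        = (1 - t) *\<^sub>R (x + a *\<^sub>R (y - x)) + t *\<^sub>R (x + b *\<^sub>R (y - x))"
      by (simp add: algebra_simps)
    then show "?h ((1 - t) *\<^sub>R a + t *\<^sub>R b) \<le> (1 - t) * ?h a + t * ?h b"
      using convex_onD[OF assms(2), of t "x + a *\<^sub>R (y - x)" "x + b *\<^sub>R (y - x)"] t by simp
  qed simp
  then have "?h 1 - ?h 0 \<ge> inner (grad f (x + 0 *\<^sub>R (y - x))) (y - x) * (1 - 0)"
    by (rule convex_on_imp_above_tangent)
      (simp_all add: L_smooth_deriv_along_line[OF assms(1), of x _ 0, simplified])
  then show ?thesis by (simp add: bregman_def)
qed

text \<open>
  The descent lemma. Along the line from \<open>x\<close> to \<open>y\<close> the difference of the two sides is
  monotone, because the Lipschitz condition determines the sign of its derivative.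
\<close>

lemma bregman_le_quadratic:
  assumes "L_smooth L f"
  shows "bregman f y x \<le> L / 2 * (norm (y - x))\<^sup>2"
proof -
  define d where "d = y - x"
  let ?h = "\<lambda>t. f (x + t *\<^sub>R d) - t * inner (grad f x) d - L / 2 * t\<^sup>2 * (norm d)\<^sup>2"
  have "?h 1 \<le> ?h 0"
  proof (rule DERIV_nonpos_imp_nonincreasing[of 0 1 ?h])
    fix t :: real assume t: "0 \<le> t" "t \<le> 1"
    let ?D = "inner (grad f (x + t *\<^sub>R d)) d - inner (grad f x) d - L * t * (norm d)\<^sup>2"
    have "(?h has_real_derivative ?D) (at t)"
      by (auto intro!: derivative_eq_intros L_smooth_deriv_along_line[OF assms])
    moreover have "?D \<le> 0"
    proof -
      have "inner (grad f (x + t *\<^sub>R d) - grad f x) d \<le> norm (grad f (x + t *\<^sub>R d) - grad f x) * norm d"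
        by (rule norm_cauchy_schwarz)
      also have "\<dots> \<le> (L * norm (t *\<^sub>R d)) * norm d"
        using L_smooth_lipschitz[OF assms, of "x + t *\<^sub>R d" x]
        by (intro mult_right_mono) auto
      also have "\<dots> = L * t * (norm d)\<^sup>2"
        using t by (simp add: power2_eq_square)
      finally show ?thesis by (simp add: inner_diff_left)
    qed
    ultimately show "\<exists>D. (?h has_real_derivative D) (at t) \<and> D \<le> 0" by blast
  qed simp
  then show ?thesis by (simp add: bregman_def d_def)
qed

text \<open>
  Cocoercivity: a gradient step of length \<open>1/L\<close> from \<open>y\<close> on the function \<open>bregman f _ x\<close> decreases it
  by at least the left-hand side, and the result is still nonnegative.
\<close>

lemma bregman_ge_grad_diff:
  assumes smooth: "L_smooth L f" and convex: "convex_on UNIV f" and L: "0 < L"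
  shows "(norm (grad f y - grad f x))\<^sup>2 / (2 * L) \<le> bregman f y x"
proof -
  define r where "r = grad f y - grad f x"
  define v where "v = y - (1 / L) *\<^sub>R r"
  have "0 \<le> bregman f v x" using smooth convex by (rule bregman_nonneg)
  moreover have "bregman f v y \<le> L / 2 * (norm (v - y))\<^sup>2"
    using smooth by (rule bregman_le_quadratic)
  moreover have "bregman f v x = bregman f v y + bregman f y x + inner r (v - y)"
    by (simp add: bregman_def r_def inner_diff_left inner_diff_right)
  moreover have "L / 2 * (norm (v - y))\<^sup>2 = (norm r)\<^sup>2 / (2 * L)"
    using L by (simp add: v_def power2_eq_square field_simps)
  moreover have "inner r (v - y) = - ((norm r)\<^sup>2 / L)"
    by (simp add: v_def power2_norm_eq_inner)
  moreover have "(norm r)\<^sup>2 / L = 2 * ((norm r)\<^sup>2 / (2 * L))" by simp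
  ultimately have "(norm r)\<^sup>2 / (2 * L) \<le> bregman f y x" by linarith
  then show ?thesis by (simp add: r_def)
qed

section \<open>Sampling without replacement\<close>

lemma sum_perms_swap:
  assumes "j \<in> {1..n}" "k \<in> {1..n}"
  shows "(\<Sum>p\<in>perms n. \<phi> p) = (\<Sum>p\<in>perms n. \<phi> (p \<circ> Transposition.transpose j k))"
  by (rule sum_permutations_compose_right) (use assms in \<open>simp add: permutes_swap_id\<close>)

text \<open>
  Every coordinate of a uniform random permutation of \<open>{1..n}\<close> is uniform on \<open>{1..n}\<close>, stated
  as a count.
\<close>

lemma sum_perms_coordinate:
  fixes \<phi> :: "nat \<Rightarrow> real"
  assumes k: "k \<in> {1..n}"
  shows "real n * (\<Sum>p\<in>perms n. \<phi> (p k)) = card (perms n) * (\<Sum>i\<in>{1..n}. \<phi> i)"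
proof -
  have coordinate_eq: "(\<Sum>p\<in>perms n. \<phi> (p j)) = (\<Sum>p\<in>perms n. \<phi> (p k))" if "j \<in> {1..n}" for j
    using sum_perms_swap[OF k that, of "\<lambda>p. \<phi> (p k)"] by simp
  have "(\<Sum>j\<in>{1..n}. \<Sum>p\<in>perms n. \<phi> (p j)) = (\<Sum>j\<in>{1..n}. \<Sum>p\<in>perms n. \<phi> (p k))"
    by (rule sum.cong[OF refl coordinate_eq])
  then have "real n * (\<Sum>p\<in>perms n. \<phi> (p k)) = (\<Sum>j\<in>{1..n}. \<Sum>p\<in>perms n. \<phi> (p j))"
    by simp
  also have "\<dots> = (\<Sum>p\<in>perms n. \<Sum>j\<in>{1..n}. \<phi> (p j))"
    by (rule sum.swap)
  also have "\<dots> = (\<Sum>p\<in>perms n. \<Sum>i\<in>{1..n}. \<phi> i)"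
    by (intro sum.cong refl sum.permute[where g=\<phi>, unfolded comp_def, symmetric]) simp
  finally show ?thesis by simp
qed

text \<open>
  The negative correlation. Given the first \<open>i\<close> samples, all later positions are exchangeable,
  so each has the same correlation with the partial sum \<open>S\<close>; together the later samples add up
  to \<open>-S\<close>, and the correlations to \<open>-|S|\<^sup>2\<close>.
\<close>

lemma sum_perms_partial_sum_inner_le_0:
  fixes x :: "nat \<Rightarrow> 'v::real_inner"
  assumes centred: "(\<Sum>i\<in>{1..n}. x i) = 0" and i: "i < n"
  shows "(\<Sum>p\<in>perms n. inner (\<Sum>j\<in>{1..i}. x (p j)) (x (p (Suc i)))) \<le> 0"
proof -
  define S where "S = (\<lambda>p. \<Sum>j\<in>{1..i}. x (p j))"
  define \<kappa> where "\<kappa> = (\<Sum>p\<in>perms n. inner (S p) (x (p (Suc i))))"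
  have swap: "\<kappa> = (\<Sum>p\<in>perms n. inner (S p) (x (p k)))" if "k \<in> {Suc i..n}" for k
  proof -
    have "S (p \<circ> Transposition.transpose (Suc i) k) = S p" for p
      unfolding S_def by (intro sum.cong) (use that in \<open>auto simp: Transposition.transpose_def\<close>)
    then show ?thesis
      unfolding \<kappa>_def using that i
      by (subst sum_perms_swap[of "Suc i" n k]) auto
  qed
  have "real (n - i) * \<kappa> = (\<Sum>k\<in>{Suc i..n}. \<Sum>p\<in>perms n. inner (S p) (x (p k)))"
    using i swap[symmetric] by (simp add: of_nat_diff)
  also have "\<dots> = (\<Sum>p\<in>perms n. inner (S p) (\<Sum>k\<in>{Suc i..n}. x (p k)))"
    by (subst sum.swap) (simp add: inner_sum_right)
  also have "\<dots> = (\<Sum>p\<in>perms n. - (norm (S p))\<^sup>2)"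
  proof (intro sum.cong refl)
    fix p assume "p \<in> perms n"
    then have "(\<Sum>k\<in>{1..n}. x (p k)) = 0"
      using centred sum.permute[of p "{1..n}" x] by (simp add: comp_def)
    moreover have "(\<Sum>k\<in>{1..n}. x (p k)) = S p + (\<Sum>k\<in>{Suc i..n}. x (p k))"
      unfolding S_def using i
      by (subst sum.union_disjoint[symmetric]) (auto intro!: sum.cong)
    ultimately have "(\<Sum>k\<in>{Suc i..n}. x (p k)) = - S p" by (simp add: eq_neg_iff_add_eq_0 add.commute)
    then show "inner (S p) (\<Sum>k\<in>{Suc i..n}. x (p k)) = - (norm (S p))\<^sup>2"
      by (simp add: power2_norm_eq_inner)
  qed
  also have "\<dots> \<le> 0" by (intro sum_nonpos) simp
  finally have "real (n - i) * \<kappa> \<le> 0" .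
  then show ?thesis using i by (simp add: \<kappa>_def S_def mult_le_0_iff)
qed

text \<open>
  Averaged over the permutations: at most \<open>i\<close> times the variance, the value for
  independent samples. The exact value has an additional factor \<open>(n - i)/(n - 1)\<close>.
\<close>

lemma sum_perms_partial_sum_sq_le:
  fixes x :: "nat \<Rightarrow> 'v::real_inner"
  assumes centred: "(\<Sum>i\<in>{1..n}. x i) = 0" and "i \<le> n"
  shows "real n * (\<Sum>p\<in>perms n. (norm (\<Sum>j\<in>{1..i}. x (p j)))\<^sup>2)
     \<le> real i * (card (perms n) * (\<Sum>k\<in>{1..n}. (norm (x k))\<^sup>2))"
  using assms(2)
proof (induction i)
  case (Suc i)
  let ?S = "\<lambda>p. \<Sum>j\<in>{1..i}. x (p j)" and ?x = "\<lambda>p. x (p (Suc i))"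
  have "(\<Sum>p\<in>perms n. (norm (\<Sum>j\<in>{1..Suc i}. x (p j)))\<^sup>2)
      = (\<Sum>p\<in>perms n. (norm (?S p))\<^sup>2) + 2 * (\<Sum>p\<in>perms n. inner (?S p) (?x p))
        + (\<Sum>p\<in>perms n. (norm (?x p))\<^sup>2)"
    by (simp add: power2_norm_eq_inner inner_add_left inner_add_right inner_commute
        sum.distrib sum_distrib_left algebra_simps)
  also have "\<dots> \<le> (\<Sum>p\<in>perms n. (norm (?S p))\<^sup>2) + (\<Sum>p\<in>perms n. (norm (?x p))\<^sup>2)"
    using sum_perms_partial_sum_inner_le_0[OF centred, of i] Suc.prems by simp
  finally have "real n * (\<Sum>p\<in>perms n. (norm (\<Sum>j\<in>{1..Suc i}. x (p j)))\<^sup>2)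
      \<le> real n * (\<Sum>p\<in>perms n. (norm (?S p))\<^sup>2) + real n * (\<Sum>p\<in>perms n. (norm (?x p))\<^sup>2)"
    by (simp only: distrib_left[symmetric] mult_left_mono of_nat_0_le_iff)
  also have "\<dots> \<le> real i * (card (perms n) * (\<Sum>k\<in>{1..n}. (norm (x k))\<^sup>2))
      + card (perms n) * (\<Sum>k\<in>{1..n}. (norm (x k))\<^sup>2)"
  proof (rule add_mono)
    show "real n * (\<Sum>p\<in>perms n. (norm (?S p))\<^sup>2)
        \<le> real i * (card (perms n) * (\<Sum>k\<in>{1..n}. (norm (x k))\<^sup>2))"
      using Suc by (meson Suc_leD)
    show "real n * (\<Sum>p\<in>perms n. (norm (?x p))\<^sup>2)
        \<le> card (perms n) * (\<Sum>k\<in>{1..n}. (norm (x k))\<^sup>2)"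
      using sum_perms_coordinate[of "Suc i" n "\<lambda>k. (norm (x k))\<^sup>2"] Suc.prems
      by (simp del: One_nat_def)
  qed
  finally show ?case by (simp add: algebra_simps)
qed simp

text \<open>
  The mean over the steps \<open>i < n\<close> of an epoch of the squared norm of \<open>1/n\<close> times the \<open>i\<close>-th
  partial sum; this is where the third power of \<open>n\<close> comes from.
\<close>

definition shuffle_noise :: "(nat \<Rightarrow> 'v::real_inner) \<Rightarrow> nat \<Rightarrow> (nat \<Rightarrow> nat) \<Rightarrow> real" where
  "shuffle_noise x n p = (\<Sum>i<n. (norm (\<Sum>j\<in>{1..i}. x (p j)))\<^sup>2) / real n ^ 3"

lemma shuffle_noise_nonneg: "0 \<le> shuffle_noise x n p"
  by (simp add: shuffle_noise_def sum_nonneg)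

lemma sum_perms_shuffle_noise_le:
  fixes x :: "nat \<Rightarrow> 'v::real_inner"
  assumes centred: "(\<Sum>i\<in>{1..n}. x i) = 0" and n: "1 \<le> n"
  shows "(\<Sum>p\<in>perms n. shuffle_noise x n p) / card (perms n)
     \<le> (\<Sum>k\<in>{1..n}. (norm (x k))\<^sup>2) / (2 * (real n)\<^sup>2)"
proof -
  define V where "V = (\<Sum>k\<in>{1..n}. (norm (x k))\<^sup>2)"
  define C where "C = real (card (perms n))"
  have C: "0 < C"
    unfolding C_def using card_permutations[of "{1..n}" n] by simp
  have V: "0 \<le> V" by (simp add: V_def sum_nonneg)
  have "real n ^ 4 * (\<Sum>p\<in>perms n. shuffle_noise x n p)
      = (\<Sum>i<n. real n * (\<Sum>p\<in>perms n. (norm (\<Sum>j\<in>{1..i}. x (p j)))\<^sup>2))"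
    unfolding shuffle_noise_def sum_distrib_left[symmetric] using n
    by (subst sum.swap) (simp add: sum_divide_distrib[symmetric] power_def eval_nat_numeral)
  also have "\<dots> \<le> (\<Sum>i<n. real i * (C * V))"
    unfolding C_def V_def by (intro sum_mono sum_perms_partial_sum_sq_le centred) simp
  also have "\<dots> = (\<Sum>i<n. real i) * (C * V)"
    by (simp add: sum_distrib_right)
  also have "(\<Sum>i<n. real i) \<le> (real n)\<^sup>2 / 2"
    by (induction n) (auto simp: power2_eq_square field_simps)
  finally have "real n ^ 4 * (\<Sum>p\<in>perms n. shuffle_noise x n p) \<le> (real n)\<^sup>2 / 2 * (C * V)"
    using C V by (simp add: mult_right_mono)
  then have "(real n)\<^sup>2 * ((real n)\<^sup>2 * (\<Sum>p\<in>perms n. shuffle_noise x n p)) \<le> (real n)\<^sup>2 * (C * V / 2)"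
    by (simp add: power_add[of "real n" 2 2, simplified])
  then have "(real n)\<^sup>2 * (\<Sum>p\<in>perms n. shuffle_noise x n p) \<le> C * V / 2"
    by (rule mult_left_le_imp_le) (use n in simp)
  then have "(\<Sum>p\<in>perms n. shuffle_noise x n p) / C \<le> V / (2 * (real n)\<^sup>2)"
    using n C by (simp add: field_simps)
  then show ?thesis by (simp add: C_def V_def)
qed

section \<open>The decrease of the potential over an epoch\<close>

lemma norm_sum_sq_le:
  fixes v :: "'i \<Rightarrow> 'v::real_normed_vector"
  shows "(norm (\<Sum>i\<in>A. v i))\<^sup>2 \<le> real (card A) * (\<Sum>i\<in>A. (norm (v i))\<^sup>2)"
proof -
  have "(norm (\<Sum>i\<in>A. v i))\<^sup>2 \<le> (\<Sum>i\<in>A. norm (v i))\<^sup>2"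
    by (intro power_mono norm_sum) simp
  also have "\<dots> \<le> real (card A) * (\<Sum>i\<in>A. (norm (v i))\<^sup>2)"
    using sum_squared_le_sum_of_squares[of "\<lambda>i. norm (v i)" A] by (simp add: mult.commute)
  finally show ?thesis .
qed

lemma norm_add_sq_le:
  fixes x y :: "'v::real_inner"
  shows "(norm (x + y))\<^sup>2 \<le> 2 * (norm x)\<^sup>2 + 2 * (norm y)\<^sup>2"
  using zero_le_power2[of "norm (x - y)"]
  by (simp add: power2_norm_eq_inner inner_add_left inner_add_right inner_diff_left inner_diff_right
      inner_commute)

lemma norm_convex_combination_sq_le:
  fixes x y :: "'v::real_inner"
  assumes "0 \<le> t" "t \<le> 1"
  shows "(norm (t *\<^sub>R x + (1 - t) *\<^sub>R y))\<^sup>2 \<le> t * (norm x)\<^sup>2 + (1 - t) * (norm y)\<^sup>2"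
proof -
  have "t * (norm x)\<^sup>2 + (1 - t) * (norm y)\<^sup>2 - (norm (t *\<^sub>R x + (1 - t) *\<^sub>R y))\<^sup>2
      = t * (1 - t) * (norm (x - y))\<^sup>2"
    by (simp add: power2_norm_eq_inner inner_add_left inner_add_right inner_diff_left
        inner_diff_right inner_commute algebra_simps)
  moreover have "0 \<le> t * (1 - t) * (norm (x - y))\<^sup>2" using assms by simp
  ultimately show ?thesis by linarith
qed

text \<open>
  Since \<open>smg_inner\<close> restarts every momentum step from the momentum \<open>m\<close> of the epoch's start, an
  iterate is an explicit combination of \<open>m\<close> and the gradients seen so far. These gradients
  depend on the earlier iterates, so they are kept as a named sequence.
\<close>

definition inner_grad ::
  "(nat \<Rightarrow> 'v \<Rightarrow> real) \<Rightarrow> nat \<Rightarrow> real \<Rightarrow> real \<Rightarrow> (nat \<Rightarrow> nat) \<Rightarrow> 'v \<Rightarrow> 'v \<Rightarrow> nat \<Rightarrow> 'v::real_inner" where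
  "inner_grad f n \<beta> \<eta> p w m i = grad (f (p (Suc i))) (fst (smg_inner f n \<beta> \<eta> p w m i))"

lemma smg_inner_iterate:
  "fst (smg_inner f n \<beta> \<eta> p w m i) =
     w - (\<beta> * (real i * \<eta> / real n)) *\<^sub>R m
       - ((1 - \<beta>) * (\<eta> / real n)) *\<^sub>R (\<Sum>j<i. inner_grad f n \<beta> \<eta> p w m j)"
proof (induction i)
  case (Suc i)
  have "fst (smg_inner f n \<beta> \<eta> p w m (Suc i)) = fst (smg_inner f n \<beta> \<eta> p w m i)
      - (\<eta> / real n) *\<^sub>R (\<beta> *\<^sub>R m + (1 - \<beta>) *\<^sub>R inner_grad f n \<beta> \<eta> p w m i)"
    by (simp add: inner_grad_def Let_def case_prod_beta)
  moreover have "\<beta> * (real (Suc i) * \<eta> / real n) = \<beta> * (real i * \<eta> / real n) + \<eta> / real n * \<beta>"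
    by (simp add: distrib_left distrib_right add_divide_distrib)
  ultimately show ?case
    unfolding Suc.IH by (simp add: scaleR_add_left scaleR_add_right mult.commute)
qed simp

lemma smg_inner_average:
  "snd (snd (smg_inner f n \<beta> \<eta> p w m i)) = (1 / real n) *\<^sub>R (\<Sum>j<i. inner_grad f n \<beta> \<eta> p w m j)"
  by (induction i) (simp_all add: inner_grad_def Let_def case_prod_beta scaleR_add_right)

locale smooth_convex_sum =
  fixes f :: "nat \<Rightarrow> 'v::real_inner \<Rightarrow> real" and n :: nat and L :: real and wstar :: 'v
  assumes n_ge_1: "1 \<le> n"
    and L_pos: "0 < L"
    and convex: "\<And>i. i \<in> {1..n} \<Longrightarrow> convex_on UNIV (f i)"
    and smooth: "\<And>i. i \<in> {1..n} \<Longrightarrow> L_smooth L (f i)"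
    and minimizer: "\<And>w. avg_objective n f wstar \<le> avg_objective n f w"
begin

definition gap :: "'v \<Rightarrow> real" where
  "gap w = avg_objective n f w - avg_objective n f wstar"

definition grad_star :: "nat \<Rightarrow> 'v" where
  "grad_star i = grad (f i) wstar"

lemma gap_nonneg: "0 \<le> gap w"
  using minimizer by (simp add: gap_def)

text \<open>
  First-order optimality: by the descent lemma, a step of length \<open>1/L\<close> along the negative mean
  gradient at \<open>wstar\<close> lowers the average objective by at least \<open>|g|\<^sup>2/(2L)\<close>, so minimality forces \<open>g = 0\<close>.
\<close>

lemma sum_grad_star: "(\<Sum>i\<in>{1..n}. grad_star i) = 0"
proof -
  define g where "g = (1 / real n) *\<^sub>R (\<Sum>i\<in>{1..n}. grad_star i)"
  define v where "v = wstar - (1 / L) *\<^sub>R g"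
  have "(\<Sum>i\<in>{1..n}. f i v - f i wstar)
      \<le> (\<Sum>i\<in>{1..n}. inner (grad_star i) (v - wstar) + L / 2 * (norm (v - wstar))\<^sup>2)"
  proof (rule sum_mono)
    fix i assume "i \<in> {1..n}"
    then show "f i v - f i wstar \<le> inner (grad_star i) (v - wstar) + L / 2 * (norm (v - wstar))\<^sup>2"
      using bregman_le_quadratic[OF smooth, of i v wstar] by (simp add: bregman_def grad_star_def)
  qed
  also have "\<dots> = real n * (inner g (v - wstar) + L / 2 * (norm (v - wstar))\<^sup>2)"
    using n_ge_1 by (simp add: g_def sum.distrib inner_sum_left distrib_left)
  also have "inner g (v - wstar) + L / 2 * (norm (v - wstar))\<^sup>2 = - ((norm g)\<^sup>2 / (2 * L))"
    using L_pos by (simp add: v_def power2_norm_eq_inner[symmetric] field_simps power2_eq_square)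
  finally have "(\<Sum>i\<in>{1..n}. f i v - f i wstar) \<le> - (real n * ((norm g)\<^sup>2 / (2 * L)))"
    by simp
  moreover have "0 \<le> (\<Sum>i\<in>{1..n}. f i v - f i wstar)"
    using minimizer[of v] n_ge_1 by (simp add: avg_objective_def sum_subtractf divide_le_cancel)
  ultimately have "real n * ((norm g)\<^sup>2 / (2 * L)) \<le> 0" by linarith
  then have "g = 0"
    using n_ge_1 L_pos by (simp add: mult_le_0_iff divide_le_0_iff)
  then show ?thesis using n_ge_1 by (simp add: g_def)
qed

lemma gap_shuffled:
  assumes p: "p permutes {1..n}"
  shows "gap w = (\<Sum>i<n. f (p (Suc i)) w - f (p (Suc i)) wstar) / real n"
proof -
  have "(\<Sum>i\<in>{1..n}. F i) = (\<Sum>i<n. F (p (Suc i)))" for F :: "nat \<Rightarrow> real"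
    using sum.permute[OF p, of F] by (simp add: sum.atLeast1_atMost_eq)
  note this[of "\<lambda>i. f i w - f i wstar"]
  then show ?thesis
    by (simp only: gap_def avg_objective_def sum_subtractf diff_divide_distrib[symmetric])
qed

text \<open>
  The linear terms of the component divergences cancel because the gradients at \<open>wstar\<close> sum
  to zero. The gap thereby controls how far the component gradients at \<open>w\<close> are from those at
  \<open>wstar\<close>.
\<close>

lemma gap_eq_bregman:
  assumes p: "p permutes {1..n}"
  shows "gap w = (\<Sum>i<n. bregman (f (p (Suc i))) w wstar) / real n"
proof -
  have "(\<Sum>i<n. grad_star (p (Suc i))) = 0"
    using sum.permute[OF p, of grad_star] sum_grad_star by (simp add: sum.atLeast1_atMost_eq)
  then have "(\<Sum>i<n. inner (grad_star (p (Suc i))) (w - wstar)) = 0"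
    by (simp add: inner_sum_left[symmetric])
  then show ?thesis
    by (simp add: gap_shuffled[OF p] bregman_def sum_subtractf grad_star_def)
qed

text \<open>
  The first summand is the distance of the momentum-free variable \<open>z\<close> to the minimizer. The
  second stores, for use in epoch \<open>t\<close>, a multiple of \<open>|u\<^bsub>t-1\<^esub>|\<^sup>2 = |\<eta>m|\<^sup>2\<close>: \<open>q/2\<close> of it pays for the cross term with \<open>u\<^sub>t\<close>, and
  \<open>sqrt (1 + q) * q / 4\<close> for the momentum's share of the drift in epoch \<open>t\<close>. Here \<open>m\<close> is the
  momentum entering epoch \<open>t\<close> and \<open>\<eta>\<close> the learning rate of epoch \<open>t - 1\<close>, which produced it.
\<close>

definition potential :: "real \<Rightarrow> real \<Rightarrow> real \<Rightarrow> 'v \<Rightarrow> 'v \<Rightarrow> real" where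
  "potential \<beta> q \<eta> w m =
     (norm (w - (q * \<eta>) *\<^sub>R m - wstar))\<^sup>2 / (2 * (1 - \<beta> + q))
     + (q / 2 + sqrt (1 + q) * q / 4) * (norm (\<eta> *\<^sub>R m))\<^sup>2"

end

text \<open>
  The scalar inequality behind \<open>epoch_decrease\<close>, for \<open>x = L\<eta>\<close>: the left-hand side collects, after
  scaling by \<open>2L/\<eta>\<close>, every multiple of the gradient deviation that is produced, the right-hand
  side what cocoercivity and the fraction \<open>q\<close> of the gap pay for.
\<close>

lemma epoch_coefficient_le:
  fixes \<beta> q x :: real
  assumes q: "0 \<le> q" "q \<le> \<beta>" and "\<beta> < 1" and x: "0 \<le> x" "x * sqrt (1 + q) \<le> 1 / 2"
  shows "((1 - \<beta> + q) + 2 * q + sqrt (1 + q) * q / 2) * x + 2 * (1 + q) * (1 - \<beta>) * x\<^sup>2 \<le> 1 + q / 2"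
proof -
  define s where "s = sqrt (1 + q)"
  have s: "0 < s" "s\<^sup>2 = 1 + q" using q by (auto simp: s_def)
  have xs: "x * s \<le> 1 / 2" using x by (simp add: s_def)
  \<comment> \<open>The bounds \<open>c\<close> and \<open>d\<close> below leave \<open>(1 + 3q/2)/2\<close> of \<open>1 + q/2\<close> for \<open>(1 + 2q)x\<close>, and \<open>x s \<le> 1/2\<close>.\<close>
  have "(1 + 2 * q)\<^sup>2 \<le> (s * (1 + 3 * q / 2))\<^sup>2"
  proof -
    have "(s * (1 + 3 * q / 2))\<^sup>2 - (1 + 2 * q)\<^sup>2 = (1 + q) * (1 + 3 * q / 2)\<^sup>2 - (1 + 2 * q)\<^sup>2"
      by (simp add: power_mult_distrib s)
    also have "\<dots> = q\<^sup>2 * (5 / 4 + 9 / 4 * q)"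
      by (simp add: power2_eq_square algebra_simps)
    finally have "(s * (1 + 3 * q / 2))\<^sup>2 - (1 + 2 * q)\<^sup>2 = q\<^sup>2 * (5 / 4 + 9 / 4 * q)" .
    moreover have "0 \<le> q\<^sup>2 * (5 / 4 + 9 / 4 * q)" using q by simp
    ultimately show ?thesis by linarith
  qed
  then have "1 + 2 * q \<le> s * (1 + 3 * q / 2)"
    by (rule power2_le_imp_le) (use q s in simp)
  then have "(1 + 2 * q) * x \<le> (s * (1 + 3 * q / 2)) * x"
    using x by (intro mult_right_mono) auto
  also have "\<dots> = (x * s) * (1 + 3 * q / 2)" by simp
  also have "\<dots> \<le> 1 / 2 * (1 + 3 * q / 2)" using xs q by (intro mult_right_mono) auto
  finally have a: "(1 + 2 * q) * x \<le> 1 / 2 + 3 * q / 4" by simp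
  have b: "((1 - \<beta> + q) + 2 * q) * x \<le> (1 + 2 * q) * x"
    using q x by (intro mult_right_mono) auto
  have c: "s * q / 2 * x \<le> q / 4"
    using mult_right_mono[OF xs, of "q / 2"] q by (simp add: algebra_simps)
  have "2 * (1 + q) * (1 - \<beta>) * x\<^sup>2 = 2 * (1 - \<beta>) * (x * s)\<^sup>2"
    by (simp add: power_mult_distrib s(2) algebra_simps)
  also have "\<dots> \<le> 2 * (1 - \<beta>) * (1 / 2)\<^sup>2"
  proof (rule mult_left_mono)
    show "(x * s)\<^sup>2 \<le> (1 / 2)\<^sup>2" by (rule power_mono[OF xs]) (use x(1) s(1) in simp)
  qed (use \<open>\<beta> < 1\<close> in simp)
  also have "\<dots> = (1 - \<beta>) / 2" by (simp add: power2_eq_square)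
  also have "\<dots> \<le> (1 - q) / 2" using q by simp
  finally have d: "2 * (1 + q) * (1 - \<beta>) * x\<^sup>2 \<le> (1 - q) / 2" .
  have "((1 - \<beta> + q) + 2 * q + s * q / 2) * x = ((1 - \<beta> + q) + 2 * q) * x + s * q / 2 * x"
    by (simp add: algebra_simps)
  then have "((1 - \<beta> + q) + 2 * q + s * q / 2) * x + 2 * (1 + q) * (1 - \<beta>) * x\<^sup>2
      \<le> (1 / 2 + 3 * q / 4) + q / 4 + (1 - q) / 2"
    using order_trans[OF b a] c d by (simp only: add_mono)
  also have "\<dots> = 1 + q / 2" by (simp add: field_simps)
  finally show ?thesis by (simp add: s_def)
qed

text \<open>
  A single epoch with learning rate \<open>\<eta>\<close> and permutation \<open>p\<close>, started from the iterate \<open>w\<close> and the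
  momentum \<open>m\<close>; \<open>\<eta>'\<close> is the learning rate of the previous epoch. The first epoch fits this pattern with the
  value of the schedule at 0 for \<open>\<eta>'\<close>, because its momentum is zero.
\<close>

locale smg_epoch = smooth_convex_sum f n L wstar
  for f :: "nat \<Rightarrow> 'v::real_inner \<Rightarrow> real" and n L wstar +
  fixes \<alpha> \<beta> \<eta>' \<eta> :: real and w m :: 'v and p :: "nat \<Rightarrow> nat"
  assumes beta: "0 \<le> \<beta>" "\<beta> < 1"
    and alpha: "0 \<le> \<alpha>" "\<alpha> \<le> 1"
    and eta: "0 < \<eta>" "\<eta> = \<alpha> * \<eta>'"
    and eta_le: "\<eta> \<le> 1 / (2 * L * sqrt (1 + \<alpha> * \<beta>))"
    and p: "p permutes {1..n}"
begin

definition "inner_iter i = fst (smg_inner f n \<beta> \<eta> p w m i)"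
definition "sgrad i = inner_grad f n \<beta> \<eta> p w m i"
definition "sgrad_star i = grad_star (p (Suc i))"
definition "mean_grad = (1 / real n) *\<^sub>R (\<Sum>i<n. sgrad i)"
definition "grad_dev = (\<Sum>i<n. (norm (sgrad i - sgrad_star i))\<^sup>2) / real n"
definition "mean_drift = (\<Sum>i<n. (norm (w - inner_iter i))\<^sup>2) / real n"
definition "noise = shuffle_noise grad_star n p"

lemma shuffled_index: "i < n \<Longrightarrow> p (Suc i) \<in> {1..n}"
  using permutes_in_image[OF p, of "Suc i"] by simp

text \<open>
  For each step, the component's gap is the inner product with the gradient used, plus the
  divergence from the inner iterate to \<open>w\<close>, minus that to \<open>wstar\<close>. The descent lemma bounds
  the former from above and cocoercivity the latter from below.
\<close>

lemma gap_le:
  "gap w \<le> inner mean_grad (w - wstar) + L / 2 * mean_drift - grad_dev / (2 * L)"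
proof -
  have "(\<Sum>i<n. f (p (Suc i)) w - f (p (Suc i)) wstar)
      \<le> (\<Sum>i<n. inner (sgrad i) (w - wstar) + L / 2 * (norm (w - inner_iter i))\<^sup>2 - (norm (sgrad i - sgrad_star i))\<^sup>2 / (2 * L))"
  proof (rule sum_mono)
    fix i assume "i \<in> {..<n}"
    then have i: "p (Suc i) \<in> {1..n}" using shuffled_index by simp
    have sgrad_eq: "sgrad i = grad (f (p (Suc i))) (inner_iter i)" by (simp add: sgrad_def inner_iter_def inner_grad_def)
    have "bregman (f (p (Suc i))) w (inner_iter i) \<le> L / 2 * (norm (w - inner_iter i))\<^sup>2"
      by (rule bregman_le_quadratic[OF smooth[OF i]])
    moreover have "(norm (sgrad i - sgrad_star i))\<^sup>2 / (2 * L) \<le> bregman (f (p (Suc i))) wstar (inner_iter i)"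
      using bregman_ge_grad_diff[OF smooth[OF i] convex[OF i] L_pos, of wstar "inner_iter i"]
      by (simp add: sgrad_eq sgrad_star_def grad_star_def norm_minus_commute)
    moreover have "f (p (Suc i)) w - f (p (Suc i)) wstar
        = inner (sgrad i) (w - wstar) + bregman (f (p (Suc i))) w (inner_iter i)
          - bregman (f (p (Suc i))) wstar (inner_iter i)"
      by (simp add: sgrad_eq bregman_def inner_diff_right)
    ultimately show "f (p (Suc i)) w - f (p (Suc i)) wstar
        \<le> inner (sgrad i) (w - wstar) + L / 2 * (norm (w - inner_iter i))\<^sup>2 - (norm (sgrad i - sgrad_star i))\<^sup>2 / (2 * L)"
      by linarith
  qed
  also have "\<dots> = real n * (inner mean_grad (w - wstar) + L / 2 * mean_drift - grad_dev / (2 * L))"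
    using n_ge_1
    by (simp add: mean_grad_def mean_drift_def grad_dev_def sum.distrib sum_subtractf inner_sum_left
        sum_distrib_left[symmetric] sum_divide_distrib[symmetric] distrib_left right_diff_distrib)
  finally show ?thesis
    using n_ge_1 by (simp add: gap_shuffled[OF p] divide_le_eq mult.commute)
qed

text \<open>
  Go through the gradients at \<open>w\<close>: cocoercivity compares those with the gradients at
  \<open>wstar\<close>, the Lipschitz condition with the gradients at the inner iterates.
\<close>

lemma grad_dev_le: "grad_dev \<le> 4 * L * gap w + 2 * L\<^sup>2 * mean_drift"
proof -
  have "(\<Sum>i<n. (norm (sgrad i - sgrad_star i))\<^sup>2)
      \<le> (\<Sum>i<n. 4 * L * bregman (f (p (Suc i))) w wstar + 2 * L\<^sup>2 * (norm (w - inner_iter i))\<^sup>2)"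
  proof (rule sum_mono)
    fix i assume "i \<in> {..<n}"
    then have i: "p (Suc i) \<in> {1..n}" using shuffled_index by simp
    let ?e = "grad (f (p (Suc i))) w"
    have "(norm (sgrad i - sgrad_star i))\<^sup>2 \<le> 2 * (norm (?e - sgrad_star i))\<^sup>2 + 2 * (norm (sgrad i - ?e))\<^sup>2"
      using norm_add_sq_le[of "?e - sgrad_star i" "sgrad i - ?e"] by simp
    moreover have "(norm (?e - sgrad_star i))\<^sup>2 \<le> 2 * L * bregman (f (p (Suc i))) w wstar"
      using bregman_ge_grad_diff[OF smooth[OF i] convex[OF i] L_pos, of w wstar] L_pos
      by (simp add: sgrad_star_def grad_star_def divide_le_eq mult.commute)
    moreover have "(norm (sgrad i - ?e))\<^sup>2 \<le> L\<^sup>2 * (norm (w - inner_iter i))\<^sup>2"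
      using power_mono[OF L_smooth_lipschitz[OF smooth[OF i], of "inner_iter i" w] norm_ge_zero, of 2]
      by (simp add: sgrad_def inner_iter_def inner_grad_def power_mult_distrib norm_minus_commute)
    ultimately show "(norm (sgrad i - sgrad_star i))\<^sup>2
        \<le> 4 * L * bregman (f (p (Suc i))) w wstar + 2 * L\<^sup>2 * (norm (w - inner_iter i))\<^sup>2"
      by linarith
  qed
  also have "\<dots> = real n * (4 * L * gap w + 2 * L\<^sup>2 * mean_drift)"
    using n_ge_1
    by (simp add: gap_eq_bregman[OF p] mean_drift_def sum.distrib sum_distrib_left[symmetric] distrib_left)
  finally show ?thesis
    using n_ge_1 by (simp add: grad_dev_def divide_le_eq mult.commute)
qed

text \<open>
  The gradients at \<open>wstar\<close> sum to zero over the epoch, so they may be subtracted from the mean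
  gradient before applying Cauchy-Schwarz.
\<close>

lemma mean_grad_sq_le: "(norm mean_grad)\<^sup>2 \<le> grad_dev"
proof -
  have "(\<Sum>i<n. sgrad_star i) = 0"
    using sum.permute[OF p, of grad_star] sum_grad_star
    by (simp add: sum.atLeast1_atMost_eq sgrad_star_def)
  then have "mean_grad = (1 / real n) *\<^sub>R (\<Sum>i<n. sgrad i - sgrad_star i)"
    by (simp add: mean_grad_def sum_subtractf)
  then have "(norm mean_grad)\<^sup>2 = (norm (\<Sum>i<n. sgrad i - sgrad_star i))\<^sup>2 / (real n)\<^sup>2"
    by (simp add: power_divide)
  also have "\<dots> \<le> (real n * (\<Sum>i<n. (norm (sgrad i - sgrad_star i))\<^sup>2)) / (real n)\<^sup>2"
    using norm_sum_sq_le[of "\<lambda>i. sgrad i - sgrad_star i" "{..<n}"] by (intro divide_right_mono) auto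
  also have "\<dots> = grad_dev"
    using n_ge_1 by (simp add: grad_dev_def power2_eq_square)
  finally show ?thesis .
qed

text \<open>
  The displacement after \<open>i\<close> steps is a convex combination, with weights \<open>\<beta>\<close> and \<open>1 - \<beta>\<close>, of a
  momentum part and a gradient part. In the latter, the gradients are split into their
  deviation from the gradients at \<open>wstar\<close> and a partial sum of these, whose size depends on
  the permutation only.
\<close>

lemma drift_le:
  assumes i: "i < n"
  shows "(norm (w - inner_iter i))\<^sup>2 \<le> \<alpha> * \<beta> * (norm (\<eta>' *\<^sub>R m))\<^sup>2
     + (1 - \<beta>) * (2 * \<eta>\<^sup>2 * grad_dev + 2 * \<eta>\<^sup>2 * ((norm (\<Sum>j\<in>{1..i}. grad_star (p j)))\<^sup>2 / (real n)\<^sup>2))"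
proof -
  define X where "X = (real i / real n * \<alpha>) *\<^sub>R (\<eta>' *\<^sub>R m)"
  define S where "S = (\<Sum>j<i. sgrad_star j)"
  define R where "R = (\<Sum>j<i. sgrad j - sgrad_star j)"
  define Y where "Y = (\<eta> / real n) *\<^sub>R (R + S)"
  have S: "S = (\<Sum>j\<in>{1..i}. grad_star (p j))"
    by (simp add: S_def sgrad_star_def sum.atLeast1_atMost_eq)
  have "inner_iter i = w - (\<beta> * (real i * \<eta> / real n)) *\<^sub>R m - ((1 - \<beta>) * (\<eta> / real n)) *\<^sub>R (\<Sum>j<i. sgrad j)"
    by (simp add: inner_iter_def sgrad_def smg_inner_iterate)
  moreover have "(\<beta> * (real i * \<eta> / real n)) *\<^sub>R m = \<beta> *\<^sub>R X"
    by (simp add: X_def eta(2) mult_ac)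
  moreover have "(\<Sum>j<i. sgrad j) = R + S"
    by (simp add: R_def S_def sum_subtractf)
  ultimately have "w - inner_iter i = \<beta> *\<^sub>R X + (1 - \<beta>) *\<^sub>R Y"
    by (simp add: Y_def)
  then have "(norm (w - inner_iter i))\<^sup>2 \<le> \<beta> * (norm X)\<^sup>2 + (1 - \<beta>) * (norm Y)\<^sup>2"
    using norm_convex_combination_sq_le[of \<beta> X Y] beta by simp
  moreover have "\<beta> * (norm X)\<^sup>2 \<le> \<alpha> * \<beta> * (norm (\<eta>' *\<^sub>R m))\<^sup>2"
  proof -
    have "real i / real n * \<alpha> \<le> 1 * \<alpha>"
      using i alpha by (intro mult_right_mono) auto
    then have "(real i / real n * \<alpha>)\<^sup>2 \<le> \<alpha>\<^sup>2"
      using alpha by (intro power_mono) auto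
    also have "\<dots> \<le> \<alpha>" using alpha by (simp add: power2_eq_square mult_left_le)
    finally have "(real i / real n * \<alpha>)\<^sup>2 * (norm (\<eta>' *\<^sub>R m))\<^sup>2 \<le> \<alpha> * (norm (\<eta>' *\<^sub>R m))\<^sup>2"
      by (rule mult_right_mono) simp
    then have "(norm X)\<^sup>2 \<le> \<alpha> * (norm (\<eta>' *\<^sub>R m))\<^sup>2"
      unfolding X_def norm_scaleR[of "_ * \<alpha>"] power_mult_distrib power2_abs .
    from mult_left_mono[OF this beta(1)] show ?thesis by (simp add: mult_ac)
  qed
  moreover have "(norm Y)\<^sup>2 \<le> 2 * \<eta>\<^sup>2 * grad_dev + 2 * \<eta>\<^sup>2 * ((norm S)\<^sup>2 / (real n)\<^sup>2)"
  proof -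
    have "(norm R)\<^sup>2 \<le> real i * (\<Sum>j<i. (norm (sgrad j - sgrad_star j))\<^sup>2)"
      using norm_sum_sq_le[of "\<lambda>j. sgrad j - sgrad_star j" "{..<i}"] by (simp add: R_def)
    also have "\<dots> \<le> real n * (\<Sum>j<n. (norm (sgrad j - sgrad_star j))\<^sup>2)"
      using i by (intro mult_mono sum_mono2 sum_nonneg) auto
    also have "\<dots> = (real n)\<^sup>2 * grad_dev"
      using n_ge_1 by (simp add: grad_dev_def power2_eq_square)
    finally have R: "(norm R)\<^sup>2 \<le> (real n)\<^sup>2 * grad_dev" .
    have "(norm Y)\<^sup>2 = (\<eta> / real n)\<^sup>2 * (norm (R + S))\<^sup>2"
      by (simp add: Y_def power_mult_distrib power_divide)
    also have "\<dots> \<le> (\<eta> / real n)\<^sup>2 * (2 * ((real n)\<^sup>2 * grad_dev) + 2 * (norm S)\<^sup>2)"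
      using norm_add_sq_le[of R S] R by (intro mult_left_mono) auto
    also have "\<dots> = 2 * \<eta>\<^sup>2 * grad_dev + 2 * \<eta>\<^sup>2 * ((norm S)\<^sup>2 / (real n)\<^sup>2)"
      using n_ge_1 by (simp add: power_divide distrib_left)
    finally show ?thesis .
  qed
  then have "(1 - \<beta>) * (norm Y)\<^sup>2
      \<le> (1 - \<beta>) * (2 * \<eta>\<^sup>2 * grad_dev + 2 * \<eta>\<^sup>2 * ((norm S)\<^sup>2 / (real n)\<^sup>2))"
    using beta by (intro mult_left_mono) auto
  ultimately show ?thesis by (simp add: S)
qed

lemma mean_drift_le:
  "mean_drift \<le> \<alpha> * \<beta> * (norm (\<eta>' *\<^sub>R m))\<^sup>2 + 2 * (1 - \<beta>) * \<eta>\<^sup>2 * (grad_dev + noise)"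
proof -
  let ?S = "\<lambda>i. (norm (\<Sum>j\<in>{1..i}. grad_star (p j)))\<^sup>2"
  have "(\<Sum>i<n. (norm (w - inner_iter i))\<^sup>2) \<le> (\<Sum>i<n. \<alpha> * \<beta> * (norm (\<eta>' *\<^sub>R m))\<^sup>2
     + (1 - \<beta>) * (2 * \<eta>\<^sup>2 * grad_dev + 2 * \<eta>\<^sup>2 * (?S i / (real n)\<^sup>2)))"
    by (intro sum_mono drift_le) simp
  also have "\<dots> = real n * (\<alpha> * \<beta> * (norm (\<eta>' *\<^sub>R m))\<^sup>2)
      + (1 - \<beta>) * (real n * (2 * \<eta>\<^sup>2 * grad_dev) + 2 * \<eta>\<^sup>2 * ((\<Sum>i<n. ?S i) / (real n)\<^sup>2))"
    by (simp only: sum.distrib sum_distrib_left[symmetric] sum_divide_distrib[symmetric]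
        sum_constant card_lessThan mult.left_commute[of "real n"])
  also have "(\<Sum>i<n. ?S i) / (real n)\<^sup>2 = real n * noise"
    using n_ge_1 by (simp add: noise_def shuffle_noise_def power2_eq_square power3_eq_cube)
  also have "real n * (\<alpha> * \<beta> * (norm (\<eta>' *\<^sub>R m))\<^sup>2)
      + (1 - \<beta>) * (real n * (2 * \<eta>\<^sup>2 * grad_dev) + 2 * \<eta>\<^sup>2 * (real n * noise))
      = real n * (\<alpha> * \<beta> * (norm (\<eta>' *\<^sub>R m))\<^sup>2 + 2 * (1 - \<beta>) * \<eta>\<^sup>2 * (grad_dev + noise))"
    by (simp add: algebra_simps)
  finally show ?thesis
    using n_ge_1 unfolding mean_drift_def by (simp add: divide_le_eq mult.commute)
qed

lemma epoch_iterate: "inner_iter n = w - (\<beta> * \<eta>) *\<^sub>R m - ((1 - \<beta>) * \<eta>) *\<^sub>R mean_grad"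
  using n_ge_1 by (simp add: inner_iter_def smg_inner_iterate mean_grad_def sgrad_def)

text \<open>
  The change of variables that removes the momentum: \<open>z\<close> and \<open>z'\<close> differ by exactly \<open>c\<close> times
  the current gradient step \<open>u\<close>, at the price of the cross term with the previous step \<open>u'\<close>.
\<close>

lemma inner_mean_grad_eq:
  fixes z z' :: 'v
  defines "c \<equiv> 1 - \<beta> + \<alpha> * \<beta>" and "u \<equiv> \<eta> *\<^sub>R mean_grad" and "u' \<equiv> \<eta>' *\<^sub>R m"
  assumes z: "z = w - (\<alpha> * \<beta> * \<eta>') *\<^sub>R m - wstar"
    and z': "z' = inner_iter n - (\<alpha> * \<beta> * \<eta>) *\<^sub>R mean_grad - wstar"
  shows "inner u (w - wstar)
    = ((norm z)\<^sup>2 - (norm z')\<^sup>2) / (2 * c) + c / 2 * (norm u)\<^sup>2 + \<alpha> * \<beta> * inner u u'"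
proof -
  have c: "0 < c" using beta alpha by (simp add: c_def add_pos_nonneg)
  have step: "\<alpha> * \<beta> * \<eta>' = \<beta> * \<eta>" by (simp add: eta(2))
  have "z' = z - c *\<^sub>R u"
    unfolding z z' step epoch_iterate u_def c_def by (simp add: algebra_simps)
  then have "(norm z')\<^sup>2 = (norm (z - c *\<^sub>R u))\<^sup>2" by simp
  also have "\<dots> = (norm z)\<^sup>2 - 2 * c * inner u z + c\<^sup>2 * (norm u)\<^sup>2"
    unfolding power2_norm_eq_inner
    by (simp add: inner_diff_left inner_diff_right inner_commute power2_eq_square algebra_simps)
  finally have "inner u z = ((norm z)\<^sup>2 - (norm z')\<^sup>2) / (2 * c) + c / 2 * (norm u)\<^sup>2"
    using c by (simp add: field_simps power2_eq_square)
  moreover have "inner u (w - wstar) = inner u z + \<alpha> * \<beta> * inner u u'"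
    by (simp add: z u'_def inner_diff_right)
  ultimately show ?thesis by simp
qed

text \<open>
  The heart of the proof. The gap is bounded from above through \<open>gap_le\<close> and the change of
  variables, and from below, with weight \<open>q\<close>, through \<open>grad_dev_le\<close>; subtracting the two leaves
  the factor \<open>1 - q\<close> on the left. All multiples of the gradient deviation then cancel, and only
  the shuffling noise survives.
\<close>

lemma epoch_decrease:
  fixes z z' :: 'v
  assumes z: "z = w - (\<alpha> * \<beta> * \<eta>') *\<^sub>R m - wstar"
    and z': "z' = inner_iter n - (\<alpha> * \<beta> * \<eta>) *\<^sub>R mean_grad - wstar"
  shows "(1 - \<alpha> * \<beta>) * (\<eta> * gap w)
    \<le> potential \<beta> (\<alpha> * \<beta>) \<eta>' w m - potential \<beta> (\<alpha> * \<beta>) \<eta> (inner_iter n) mean_grad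
       + (1 + \<alpha> * \<beta>) * (1 - \<beta>) * L * \<eta> ^ 3 * noise"
proof -
  define q where "q = \<alpha> * \<beta>"
  define c where "c = 1 - \<beta> + q"
  define s where "s = sqrt (1 + q)"
  define U where "U = (norm (\<eta> *\<^sub>R mean_grad))\<^sup>2"
  define U' where "U' = (norm (\<eta>' *\<^sub>R m))\<^sup>2"
  define \<Delta> where "\<Delta> = ((norm z)\<^sup>2 - (norm z')\<^sup>2) / (2 * c)"
  have q: "0 \<le> q" "q \<le> \<beta>"
    using alpha beta by (auto simp: q_def mult_left_le_one_le)
  have s: "0 < s" "s\<^sup>2 = 1 + q" using q by (auto simp: s_def)
  have Ls: "L * \<eta> * s \<le> 1 / 2"
    using eta_le L_pos s by (simp add: q_def[symmetric] s_def[symmetric] field_simps)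
  have G0: "0 \<le> grad_dev" by (simp add: grad_dev_def sum_nonneg)
  have U0: "0 \<le> U'" by (simp add: U'_def)
  have U_le: "U \<le> \<eta>\<^sup>2 * grad_dev"
    using mean_grad_sq_le by (simp add: U_def power_mult_distrib mult_left_mono)
  have "2 * inner (\<eta> *\<^sub>R mean_grad) (\<eta>' *\<^sub>R m) \<le> U + U'"
    using zero_le_power2[of "norm (\<eta> *\<^sub>R mean_grad - \<eta>' *\<^sub>R m)"] unfolding U_def U'_def
    by (simp only: power2_norm_eq_inner inner_diff_left inner_diff_right inner_commute)
  from mult_left_mono[OF this q(1)]
  have cross: "q * inner (\<eta> *\<^sub>R mean_grad) (\<eta>' *\<^sub>R m) \<le> q / 2 * (U + U')" by simp

  have "\<eta> * gap w \<le> \<eta> * (inner mean_grad (w - wstar) + L / 2 * mean_drift - grad_dev / (2 * L))"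
    using gap_le eta(1) by (intro mult_left_mono) auto
  also have "\<dots> = inner (\<eta> *\<^sub>R mean_grad) (w - wstar) + \<eta> * L / 2 * mean_drift - \<eta> * grad_dev / (2 * L)"
    by (simp add: algebra_simps)
  also have "inner (\<eta> *\<^sub>R mean_grad) (w - wstar)
      = \<Delta> + c / 2 * U + q * inner (\<eta> *\<^sub>R mean_grad) (\<eta>' *\<^sub>R m)"
    using inner_mean_grad_eq[OF z z'] by (simp only: \<Delta>_def c_def q_def U_def)
  finally have gap_upper: "\<eta> * gap w
      \<le> \<Delta> + c / 2 * U + q / 2 * (U + U') + \<eta> * L / 2 * mean_drift - \<eta> * grad_dev / (2 * L)"
    using cross by linarith

  \<comment> \<open>The fraction \<open>q\<close> of the gap that is given up, in exchange for gradient deviation.\<close>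
  have "q * \<eta> / (4 * L) * grad_dev \<le> q * \<eta> / (4 * L) * (4 * L * gap w + 2 * L\<^sup>2 * mean_drift)"
    using grad_dev_le q eta(1) L_pos by (intro mult_left_mono) auto
  also have "\<dots> = q * (\<eta> * gap w) + q * (\<eta> * L / 2 * mean_drift)"
    using L_pos by (simp add: field_simps power2_eq_square)
  finally have gap_lower: "q / 2 * (\<eta> * grad_dev / (2 * L)) - q * (\<eta> * L / 2 * mean_drift) \<le> q * (\<eta> * gap w)"
    by (simp add: algebra_simps)

  \<comment> \<open>The drift enters once through the gap and, with weight \<open>q\<close>, through the given-up fraction.\<close>
  have "(1 + q) * (\<eta> * L / 2) * mean_drift
      \<le> (1 + q) * (\<eta> * L / 2) * (q * U' + 2 * (1 - \<beta>) * \<eta>\<^sup>2 * (grad_dev + noise))"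
    using mean_drift_le q eta(1) L_pos by (intro mult_left_mono) (auto simp: q_def U'_def)
  also have "\<dots> = s * (L * \<eta> * s) * (q * U' / 2)
      + (1 + q) * (1 - \<beta>) * L * \<eta> ^ 3 * grad_dev + (1 + q) * (1 - \<beta>) * L * \<eta> ^ 3 * noise"
    by (simp add: s(2)[symmetric] power2_eq_square power3_eq_cube algebra_simps)
  also have "s * (L * \<eta> * s) * (q * U' / 2) \<le> s * (1 / 2) * (q * U' / 2)"
    using Ls s q U0 by (intro mult_right_mono mult_left_mono) auto
  finally have drift: "(1 + q) * (\<eta> * L / 2 * mean_drift) \<le> s * q / 4 * U'
      + (1 + q) * (1 - \<beta>) * L * \<eta> ^ 3 * grad_dev + (1 + q) * (1 - \<beta>) * L * \<eta> ^ 3 * noise"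
    by (simp add: mult_ac)

  have absorb: "(c / 2 + q / 2 + (q / 2 + s * q / 4)) * U + (1 + q) * (1 - \<beta>) * L * \<eta> ^ 3 * grad_dev
      \<le> (1 + q / 2) * (\<eta> * grad_dev / (2 * L))"
  proof -
    let ?A = "c + 2 * q + s * q / 2"
    have "(c / 2 + q / 2 + (q / 2 + s * q / 4)) * U \<le> (?A / 2) * (\<eta>\<^sup>2 * grad_dev)"
    proof -
      have "0 \<le> ?A / 2" using q s beta by (simp add: c_def)
      from mult_left_mono[OF U_le this] show ?thesis by (simp add: field_simps)
    qed
    then have "(c / 2 + q / 2 + (q / 2 + s * q / 4)) * U + (1 + q) * (1 - \<beta>) * L * \<eta> ^ 3 * grad_dev
        \<le> (?A / 2) * (\<eta>\<^sup>2 * grad_dev) + (1 + q) * (1 - \<beta>) * L * \<eta> ^ 3 * grad_dev"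
      by linarith
    also have "\<dots> = (?A * (L * \<eta>) + 2 * (1 + q) * (1 - \<beta>) * (L * \<eta>)\<^sup>2) * (\<eta> * grad_dev / (2 * L))"
      using L_pos by (simp add: field_simps power2_eq_square power3_eq_cube)
    also have "\<dots> \<le> (1 + q / 2) * (\<eta> * grad_dev / (2 * L))"
      using epoch_coefficient_le[OF q beta(2), of "L * \<eta>"] Ls G0 L_pos eta(1)
      by (intro mult_right_mono) (auto simp: c_def s_def)
    finally show ?thesis .
  qed

  have "potential \<beta> q \<eta>' w m - potential \<beta> q \<eta> (inner_iter n) mean_grad
      = \<Delta> + (q / 2 + s * q / 4) * U' - (q / 2 + s * q / 4) * U"
    by (simp add: potential_def z z' \<Delta>_def c_def s_def U_def U'_def q_def diff_divide_distrib mult_ac)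
  moreover have "(1 - q) * (\<eta> * gap w)
      \<le> \<Delta> + (q / 2 + s * q / 4) * U' - (q / 2 + s * q / 4) * U + (1 + q) * (1 - \<beta>) * L * \<eta> ^ 3 * noise"
  proof -
    define E where "E = \<eta> * grad_dev / (2 * L)"
    define D where "D = \<eta> * L / 2 * mean_drift"
    define P where "P = (1 + q) * (1 - \<beta>) * L * \<eta> ^ 3"
    define \<Phi> where "\<Phi> = \<eta> * gap w"
    note folds = E_def D_def P_def \<Phi>_def
    show ?thesis
      using gap_upper gap_lower drift absorb
      unfolding folds[symmetric] by (simp only: ring_distribs)
  qed
  ultimately show ?thesis by (simp add: q_def)
qed

end

context smooth_convex_sum
begin

lemma potential_nonneg:
  assumes "\<beta> < 1" "0 \<le> q"
  shows "0 \<le> potential \<beta> q \<eta> w m"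
  using assms by (simp add: potential_def)

lemma smg_epoch_decrease:
  fixes w :: 'v
  assumes beta: "0 \<le> \<beta>" "\<beta> < 1" and alpha: "0 \<le> \<alpha>" "\<alpha> \<le> 1"
    and eta: "0 < \<eta> (Suc t)" "\<eta> (Suc t) = \<alpha> * \<eta> t"
    and eta_le: "\<eta> (Suc t) \<le> 1 / (2 * L * sqrt (1 + \<alpha> * \<beta>))"
    and p: "\<pi> (Suc t) permutes {1..n}"
  defines "V \<equiv> \<lambda>k. potential \<beta> (\<alpha> * \<beta>) (\<eta> k) (fst (smg f n \<beta> \<eta> \<pi> w k)) (snd (smg f n \<beta> \<eta> \<pi> w k))"
  shows "(1 - \<alpha> * \<beta>) * (\<eta> (Suc t) * gap (smg_iterate f n \<beta> \<eta> \<pi> w t)) \<le> V t - V (Suc t)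
     + (1 + \<alpha> * \<beta>) * (1 - \<beta>) * L * \<eta> (Suc t) ^ 3 * shuffle_noise grad_star n (\<pi> (Suc t))"
proof -
  define w' where "w' = fst (smg f n \<beta> \<eta> \<pi> w t)"
  define m' where "m' = snd (smg f n \<beta> \<eta> \<pi> w t)"
  interpret smg_epoch f n L wstar \<alpha> \<beta> "\<eta> t" "\<eta> (Suc t)" w' m' "\<pi> (Suc t)"
    by unfold_locales (fact beta alpha eta eta_le p)+
  have "smg f n \<beta> \<eta> \<pi> w t = (w', m')"
    by (simp add: w'_def m'_def)
  then have "smg f n \<beta> \<eta> \<pi> w (Suc t) = (inner_iter n, mean_grad)"
    by (simp add: inner_iter_def mean_grad_def sgrad_def smg_inner_average
        case_prod_beta Let_def)
  then show ?thesis
    using epoch_decrease[OF refl refl] by (simp add: V_def w'_def m'_def smg_iterate_def noise_def)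
qed

text \<open>
  Telescope the potential. The initial momentum is zero, so the potential starts as the squared
  distance alone, and it ends nonnegative.
\<close>

lemma smg_weighted_gap_le:
  fixes w :: 'v
  assumes beta: "0 \<le> \<beta>" "\<beta> < 1" and alpha: "0 \<le> \<alpha>" "\<alpha> \<le> 1"
    and eta: "\<And>t. 0 < \<eta> t" "\<And>t. \<eta> (Suc t) = \<alpha> * \<eta> t"
    and eta_le: "\<And>t. \<eta> (Suc t) \<le> 1 / (2 * L * sqrt (1 + \<alpha> * \<beta>))"
    and p: "\<And>t. t \<in> {1..T} \<Longrightarrow> \<pi> t permutes {1..n}"
  shows "(1 - \<alpha> * \<beta>) * (\<Sum>t<T. \<eta> (Suc t) * gap (smg_iterate f n \<beta> \<eta> \<pi> w t))
     \<le> (norm (w - wstar))\<^sup>2 / (2 * (1 - \<beta> + \<alpha> * \<beta>))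
       + (1 + \<alpha> * \<beta>) * (1 - \<beta>) * L * (\<Sum>t<T. \<eta> (Suc t) ^ 3 * shuffle_noise grad_star n (\<pi> (Suc t)))"
proof -
  define V where "V = (\<lambda>k. potential \<beta> (\<alpha> * \<beta>) (\<eta> k)
    (fst (smg f n \<beta> \<eta> \<pi> w k)) (snd (smg f n \<beta> \<eta> \<pi> w k)))"
  have "0 \<le> V T"
    unfolding V_def using beta alpha by (intro potential_nonneg) auto
  have "(1 - \<alpha> * \<beta>) * (\<Sum>t<T. \<eta> (Suc t) * gap (smg_iterate f n \<beta> \<eta> \<pi> w t))
      \<le> (\<Sum>t<T. V t - V (Suc t)
        + (1 + \<alpha> * \<beta>) * (1 - \<beta>) * L * (\<eta> (Suc t) ^ 3 * shuffle_noise grad_star n (\<pi> (Suc t))))"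
    unfolding sum_distrib_left
  proof (rule sum_mono)
    fix t assume "t \<in> {..<T}"
    then have "\<pi> (Suc t) permutes {1..n}" using p by simp
    from smg_epoch_decrease[where \<eta> = \<eta> and \<pi> = \<pi> and t = t and w = w,
        OF beta alpha eta(1) eta(2) eta_le this]
    show "(1 - \<alpha> * \<beta>) * (\<eta> (Suc t) * gap (smg_iterate f n \<beta> \<eta> \<pi> w t)) \<le> V t - V (Suc t)
        + (1 + \<alpha> * \<beta>) * (1 - \<beta>) * L * (\<eta> (Suc t) ^ 3 * shuffle_noise grad_star n (\<pi> (Suc t)))"
      by (simp add: V_def mult.assoc)
  qed
  also have "\<dots> = V 0 - V T
        + (1 + \<alpha> * \<beta>) * (1 - \<beta>) * L * (\<Sum>t<T. \<eta> (Suc t) ^ 3 * shuffle_noise grad_star n (\<pi> (Suc t)))"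
    by (simp add: sum.distrib sum_distrib_left sum_lessThan_telescope')
  also have "V 0 = (norm (w - wstar))\<^sup>2 / (2 * (1 - \<beta> + \<alpha> * \<beta>))"
    by (simp add: V_def potential_def)
  finally show ?thesis using \<open>0 \<le> V T\<close> by simp
qed

end

section \<open>Measurability and independence\<close>

text \<open>
  Real-valued functions of independent variables are independent: each generates a
  sub-sigma-algebra of the corresponding original one. This passes from \<open>indep_rvs\<close>
  to \<open>indep_var\<close>, for which expectations of products factorize.
\<close>

lemma (in prob_space) indep_rvs_compose:
  assumes indep: "indep_rvs N X K Y"
    and u: "u \<in> N \<rightarrow>\<^sub>M borel" and v: "v \<in> K \<rightarrow>\<^sub>M borel"
  shows "indep_var borel (\<lambda>\<omega>. u (X \<omega>)) borel (\<lambda>\<omega>. v (Y \<omega>))"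
proof -
  have X: "X \<in> M \<rightarrow>\<^sub>M N" and Y: "Y \<in> M \<rightarrow>\<^sub>M K"
    and sets: "indep_set (sets (vimage_algebra (space M) X N)) (sets (vimage_algebra (space M) Y K))"
    using indep by (auto simp: indep_rvs_def)
  have generated: "sigma_sets (space M) {(\<lambda>\<omega>. r (Z \<omega>)) -` A \<inter> space M | A. A \<in> sets borel}
      \<subseteq> sets (vimage_algebra (space M) Z P)"
    if Z: "Z \<in> M \<rightarrow>\<^sub>M P" and r: "r \<in> P \<rightarrow>\<^sub>M borel" for Z :: "'a \<Rightarrow> 'p" and r :: "'p \<Rightarrow> 'q::topological_space" and P
  proof -
    have "Z \<in> space M \<rightarrow> space P" using Z by (rule measurable_space[THEN Pi_I])
    then have "(\<lambda>\<omega>. r (Z \<omega>)) \<in> vimage_algebra (space M) Z P \<rightarrow>\<^sub>M borel"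
      by (intro measurable_compose[OF measurable_vimage_algebra1 r])
    then have "sets (vimage_algebra (space M) (\<lambda>\<omega>. r (Z \<omega>)) borel) \<subseteq> sets (vimage_algebra (space M) Z P)"
      by (intro sets_image_in_sets) auto
    then show ?thesis by (simp add: sets_vimage_algebra)
  qed
  show ?thesis
    unfolding indep_var_eq
  proof (intro conjI)
    show "random_variable borel (\<lambda>\<omega>. u (X \<omega>))" "random_variable borel (\<lambda>\<omega>. v (Y \<omega>))"
      using X Y u v by (auto intro: measurable_compose)
    show "indep_set (sigma_sets (space M) {(\<lambda>\<omega>. u (X \<omega>)) -` A \<inter> space M |A. A \<in> sets borel})
        (sigma_sets (space M) {(\<lambda>\<omega>. v (Y \<omega>)) -` A \<inter> space M |A. A \<in> sets borel})"
      using sets unfolding indep_set_def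
      by (rule indep_sets_mono_sets) (use generated[OF X u] generated[OF Y v] in \<open>auto split: bool.split\<close>)
  qed
qed

lemma smg_cong:
  assumes "\<And>s. s \<in> {1..t} \<Longrightarrow> \<pi> s = \<pi>' s"
  shows "smg f n \<beta> \<eta> \<pi> w t = smg f n \<beta> \<eta> \<pi>' w t"
  using assms by (induction t) simp_all

context smooth_convex_sum
begin

lemma continuous_gap: "continuous_on UNIV gap"
  unfolding gap_def avg_objective_def
  by (intro continuous_intros L_smooth_continuous[OF smooth]) (use n_ge_1 in auto)

lemma continuous_smg_inner:
  assumes p: "p permutes {1..n}" and "i \<le> n"
  shows "continuous_on UNIV (\<lambda>s. smg_inner f n \<beta> \<eta> p (fst s) (snd s) i)"
  using assms(2)
proof (induction i)
  case 0
  show ?case by (auto intro!: continuous_intros)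
next
  case (Suc i)
  let ?s = "\<lambda>s. smg_inner f n \<beta> \<eta> p (fst s) (snd s) i"
  have IH: "continuous_on UNIV ?s" using Suc by simp
  have "p (Suc i) \<in> {1..n}" using permutes_in_image[OF p, of "Suc i"] Suc.prems by simp
  then have "continuous_on UNIV (grad (f (p (Suc i))))" by (intro L_smooth_continuous_grad[OF smooth])
  then have g: "continuous_on UNIV (\<lambda>s. grad (f (p (Suc i))) (fst (?s s)))"
    by (rule continuous_on_compose2) (auto intro!: continuous_intros IH)
  show ?case
    by (simp add: case_prod_beta Let_def) (intro continuous_intros IH g)
qed

end

sublocale smg_rr \<subseteq> opt: smooth_convex_sum f n L wstar
  by unfold_locales (fact n_ge_1 L_pos convex smooth minimizer)+

section \<open>Expectations over the random permutations\<close>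

context smg_rr
begin

definition alpha_T :: real where "alpha_T = lr_alpha \<rho> T"

definition step_size :: "nat \<Rightarrow> real" where "step_size = lr \<gamma> \<rho> n T"

definition iterate_gap :: "nat \<Rightarrow> 's \<Rightarrow> real" where
  "iterate_gap t \<omega> = opt.gap (smg_iterate f n \<beta> step_size (\<lambda>t. \<pi> t \<omega>) (w0 \<omega>) t)"

definition epoch_noise :: "nat \<Rightarrow> 's \<Rightarrow> real" where
  "epoch_noise t \<omega> = shuffle_noise opt.grad_star n (\<pi> t \<omega>)"

lemma alpha_T: "0 < alpha_T" "alpha_T < 1"
  using alpha by (simp_all add: alpha_T_def)

lemma step_size_Suc: "step_size (Suc t) = alpha_T * step_size t"
  by (simp add: step_size_def lr_def alpha_T_def)

lemma step_size_pos: "0 < step_size t"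
  using alpha gamma_pos n_ge_1 T_ge_1 by (simp add: step_size_def lr_def)

lemma step_size_antimono: "s \<le> t \<Longrightarrow> step_size t \<le> step_size s"
proof (induction t rule: dec_induct)
  case (step t)
  have "step_size (Suc t) \<le> step_size t"
    using alpha_T step_size_pos[of t] by (simp add: step_size_Suc mult_left_le_one_le)
  then show ?case using step by linarith
qed simp

lemma step_size_le: "step_size (Suc t) \<le> 1 / (2 * L * sqrt (1 + alpha_T * \<beta>))"
proof -
  have "step_size (Suc t) \<le> step_size 1" by (rule step_size_antimono) simp
  also have "\<dots> \<le> 1 / (2 * L * sqrt (1 + alpha_T * \<beta>))"
    using lr_bound by (simp add: step_size_def lr_def alpha_T_def mult_ac)
  finally show ?thesis .
qed

text \<open>
  An epoch is continuous in the state for each fixed permutation, and there are only finitely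
  many permutations, so it is jointly measurable in state and permutation.
\<close>

lemma smg_measurable:
  assumes "t \<le> k"
  shows "(\<lambda>h. smg f n \<beta> step_size (snd h) (fst h) t) \<in> history_space n (Suc k) \<rightarrow>\<^sub>M borel"
  using assms
proof (induction t)
  case 0
  have "(\<lambda>h. fst h) \<in> history_space n (Suc k) \<rightarrow>\<^sub>M (borel :: (real^'d) measure)"
    unfolding history_space_def by (rule measurable_fst)
  then show ?case by (simp add: borel_prod[symmetric])
next
  case (Suc t)
  let ?state = "\<lambda>h. smg f n \<beta> step_size (snd h) (fst h) t"
  define epoch where "epoch = (\<lambda>q s. (fst (smg_inner f n \<beta> (step_size (Suc t)) q (fst s) (snd s) n),
      snd (snd (smg_inner f n \<beta> (step_size (Suc t)) q (fst s) (snd s) n))))"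
  have "(\<lambda>h. epoch (snd h (Suc t)) (?state h)) \<in> history_space n (Suc k) \<rightarrow>\<^sub>M borel"
  proof (rule measurable_compose_countable'[where I = "perms n" and g = "\<lambda>h. snd h (Suc t)"
        and f = "\<lambda>q h. epoch q (?state h)"])
    fix q assume "q \<in> perms n"
    then have "continuous_on UNIV (epoch q)"
      unfolding epoch_def by (intro continuous_intros opt.continuous_smg_inner) auto
    then have "epoch q \<in> borel \<rightarrow>\<^sub>M borel" by (rule borel_measurable_continuous_onI)
    then show "(\<lambda>h. epoch q (?state h)) \<in> history_space n (Suc k) \<rightarrow>\<^sub>M borel"
      using Suc by (intro measurable_compose[of ?state _ borel "epoch q"]) auto
  next
    show "(\<lambda>h. snd h (Suc t)) \<in> history_space n (Suc k) \<rightarrow>\<^sub>M count_space (perms n)"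
      unfolding history_space_def
      by (rule measurable_compose[OF measurable_snd measurable_component_singleton])
        (use Suc.prems in simp)
    show "countable (perms n)" by (simp add: countable_finite finite_permutations)
  qed
  then show ?case by (simp add: epoch_def case_prod_beta Let_def)
qed

text \<open>
  The first \<open>T - 1\<close> epochs read only the permutations recorded in the history, which is
  what makes the gap a function of a variable independent of the output index.
\<close>

lemma iterate_gap_eq_history:
  assumes "t < T"
  shows "iterate_gap t \<omega> = opt.gap (fst (smg f n \<beta> step_size
    (snd (history w0 \<pi> (Suc T) \<omega>)) (fst (history w0 \<pi> (Suc T) \<omega>)) t))"
proof -
  have "smg f n \<beta> step_size (\<lambda>s. \<pi> s \<omega>) (w0 \<omega>) t
      = smg f n \<beta> step_size (\<lambda>s\<in>{1..<Suc T}. \<pi> s \<omega>) (w0 \<omega>) t"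
    by (rule smg_cong) (use assms in auto)
  then show ?thesis by (simp add: iterate_gap_def smg_iterate_def history_def)
qed

lemma history_gap_measurable:
  assumes "t < T"
  shows "(\<lambda>h. opt.gap (fst (smg f n \<beta> step_size (snd h) (fst h) t)))
    \<in> history_space n (Suc T) \<rightarrow>\<^sub>M borel"
proof -
  have "continuous_on UNIV (\<lambda>s :: (real^'d) \<times> (real^'d). opt.gap (fst s))"
    by (rule continuous_on_compose2[OF opt.continuous_gap]) (auto intro!: continuous_intros)
  from measurable_compose[OF smg_measurable[of t T] borel_measurable_continuous_onI[OF this]]
  show ?thesis using assms by simp
qed

lemma index_gap_indep:
  assumes "t < T"
  shows "indep_var borel (\<lambda>\<omega>. indicator {Suc t} (\<tau> \<omega>) :: real) borel (iterate_gap t)"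
proof -
  have "(\<lambda>i. indicator {Suc t} i :: real) \<in> count_space {1..T} \<rightarrow>\<^sub>M borel" by simp
  from indep_rvs_compose[OF index_indep this history_gap_measurable[OF assms]]
  show ?thesis by (simp add: iterate_gap_eq_history[OF assms, abs_def])
qed

lemma iterate_gap_measurable: "t < T \<Longrightarrow> random_variable borel (iterate_gap t)"
  using index_gap_indep[of t] by (auto simp: indep_var_eq)

lemma perm_permutes: "t \<in> {1..T} \<Longrightarrow> \<omega> \<in> space M \<Longrightarrow> \<pi> t \<omega> permutes {1..n}"
  using measurable_space[OF perm_measurable] by simp

lemma epoch_noise_integrable:
  assumes t: "t \<in> {1..T}"
  shows "integrable M (epoch_noise t)"
proof (rule integrable_const_bound)
  have "epoch_noise t \<omega> \<le> (\<Sum>p\<in>perms n. shuffle_noise opt.grad_star n p)" if "\<omega> \<in> space M" for \<omega>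
    unfolding epoch_noise_def using perm_permutes[OF t that]
    by (intro member_le_sum) (auto simp: shuffle_noise_nonneg finite_permutations)
  then show "AE \<omega> in M. norm (epoch_noise t \<omega>) \<le> (\<Sum>p\<in>perms n. shuffle_noise opt.grad_star n p)"
    by (auto simp: epoch_noise_def shuffle_noise_nonneg)
  show "epoch_noise t \<in> borel_measurable M"
    unfolding epoch_noise_def[abs_def] by (rule measurable_compose[OF perm_measurable[OF t]]) simp
qed

text \<open>
  The noise of an epoch is a function of its permutation alone, so the uniform law of
  that permutation suffices.
\<close>

lemma expectation_epoch_noise_le:
  assumes t: "t \<in> {1..T}"
  shows "expectation (epoch_noise t) \<le> grad_variance n f wstar / (2 * real n)"
proof -
  let ?noise = "shuffle_noise opt.grad_star n"
  have "expectation (epoch_noise t) = (\<integral>p. ?noise p \<partial>distr M (count_space (perms n)) (\<pi> t))"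
    unfolding epoch_noise_def[abs_def] by (rule integral_distr[OF perm_measurable[OF t], symmetric]) simp
  also have "\<dots> = (\<Sum>p\<in>perms n. ?noise p) / card (perms n)"
    unfolding perm_uniform[OF t] by (rule integral_uniform_count_measure) (simp add: finite_permutations)
  also have "\<dots> \<le> (\<Sum>k\<in>{1..n}. (norm (opt.grad_star k))\<^sup>2) / (2 * (real n)\<^sup>2)"
    by (rule sum_perms_shuffle_noise_le[OF opt.sum_grad_star n_ge_1])
  also have "\<dots> = grad_variance n f wstar / (2 * real n)"
    by (simp add: grad_variance_def opt.grad_star_def power2_eq_square)
  finally show ?thesis .
qed

definition momentum_factor :: real where "momentum_factor = alpha_T * \<beta>"

lemma momentum_factor: "0 \<le> momentum_factor" "momentum_factor \<le> \<beta>" "momentum_factor < 1"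
proof -
  show "0 \<le> momentum_factor" using alpha_T beta by (simp add: momentum_factor_def)
  show "momentum_factor \<le> \<beta>" using alpha_T beta by (simp add: momentum_factor_def mult_left_le_one_le)
  then show "momentum_factor < 1" using beta by simp
qed

text \<open>
  The pathwise bound on the weighted sum of gaps. Being integrable, it also dominates each
  gap, which is how the integrability of the gaps is obtained.
\<close>

definition regret_bound :: "'s \<Rightarrow> real" where
  "regret_bound \<omega> = (norm (w0 \<omega> - wstar))\<^sup>2 / (2 * (1 - \<beta> + momentum_factor))
     + (1 + momentum_factor) * (1 - \<beta>) * L * (\<Sum>t<T. step_size (Suc t) ^ 3 * epoch_noise (Suc t) \<omega>)"

lemma weighted_gap_le:
  assumes "\<omega> \<in> space M"
  shows "(1 - momentum_factor) * (\<Sum>t<T. step_size (Suc t) * iterate_gap t \<omega>) \<le> regret_bound \<omega>"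
  using opt.smg_weighted_gap_le[of \<beta> alpha_T step_size T "\<lambda>t. \<pi> t \<omega>" "w0 \<omega>"]
    beta alpha_T step_size_pos step_size_Suc step_size_le perm_permutes[OF _ assms]
  by (simp add: regret_bound_def iterate_gap_def epoch_noise_def momentum_factor_def)

lemma regret_bound_integrable: "integrable M regret_bound"
  unfolding regret_bound_def[abs_def]
  using w0_square_integrable
  by (intro Bochner_Integration.integrable_add integrable_mult_right Bochner_Integration.integrable_sum
      integrable_divide epoch_noise_integrable) auto

lemma iterate_gap_nonneg: "0 \<le> iterate_gap t \<omega>"
  by (simp add: iterate_gap_def opt.gap_nonneg)

lemma iterate_gap_integrable:
  assumes t: "t < T"
  shows "integrable M (iterate_gap t)"
proof (rule Bochner_Integration.integrable_bound)
  let ?c = "(1 - momentum_factor) * step_size (Suc t)"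
  show "integrable M (\<lambda>\<omega>. regret_bound \<omega> / ?c)" using regret_bound_integrable by simp
  show "iterate_gap t \<in> borel_measurable M" by (rule iterate_gap_measurable[OF t])
  show "AE \<omega> in M. norm (iterate_gap t \<omega>) \<le> norm (regret_bound \<omega> / ?c)"
  proof (rule AE_I2)
    fix \<omega> assume \<omega>: "\<omega> \<in> space M"
    have c: "0 < ?c" using momentum_factor step_size_pos by simp
    have "step_size (Suc t) * iterate_gap t \<omega> \<le> (\<Sum>t<T. step_size (Suc t) * iterate_gap t \<omega>)"
      using t step_size_pos[THEN less_imp_le] iterate_gap_nonneg
      by (intro member_le_sum[where f = "\<lambda>t. step_size (Suc t) * iterate_gap t \<omega>"]) auto
    then have "?c * iterate_gap t \<omega> \<le> (1 - momentum_factor) * (\<Sum>t<T. step_size (Suc t) * iterate_gap t \<omega>)"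
      using momentum_factor by (simp add: mult.assoc mult_left_mono)
    also have "\<dots> \<le> regret_bound \<omega>" using \<omega> by (rule weighted_gap_le)
    finally have "iterate_gap t \<omega> \<le> regret_bound \<omega> / ?c"
      using c by (simp add: pos_le_divide_eq mult.commute)
    then show "norm (iterate_gap t \<omega>) \<le> norm (regret_bound \<omega> / ?c)"
      using iterate_gap_nonneg[of t \<omega>] by (simp only: real_norm_def abs_of_nonneg)
  qed
qed

lemma grad_variance_nonneg: "0 \<le> grad_variance n f wstar"
  by (simp add: grad_variance_def sum_nonneg)

lemma step_size_cube_le: "step_size (Suc t) ^ 3 \<le> \<gamma> ^ 3 * real n / real T"
proof -
  have "step_size (Suc t) ^ 3 \<le> step_size 0 ^ 3"
    using step_size_antimono[of 0 "Suc t"] step_size_pos[of "Suc t"] by (intro power_mono) auto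
  also have "\<dots> = \<gamma> ^ 3 * (real n powr (1/3)) ^ 3 / (real T powr (1/3)) ^ 3"
    by (simp add: step_size_def lr_def power_mult_distrib power_divide)
  also have "\<dots> = \<gamma> ^ 3 * real n / real T"
    using n_ge_1 T_ge_1 by (simp add: powr_power)
  finally show ?thesis .
qed

lemma expectation_regret_bound_le:
  "expectation regret_bound \<le> expectation (\<lambda>\<omega>. (norm (w0 \<omega> - wstar))\<^sup>2) / (2 * (1 - \<beta> + momentum_factor))
     + (1 + momentum_factor) * (1 - \<beta>) * L * (\<gamma> ^ 3 * grad_variance n f wstar / 2)"
proof -
  have "expectation regret_bound = expectation (\<lambda>\<omega>. (norm (w0 \<omega> - wstar))\<^sup>2) / (2 * (1 - \<beta> + momentum_factor))
     + (1 + momentum_factor) * (1 - \<beta>) * L * (\<Sum>t<T. step_size (Suc t) ^ 3 * expectation (epoch_noise (Suc t)))"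
    unfolding regret_bound_def[abs_def]
    using w0_square_integrable epoch_noise_integrable
    by (subst Bochner_Integration.integral_add)
      (auto intro!: Bochner_Integration.integrable_sum integrable_mult_right simp: Bochner_Integration.integral_sum)
  moreover have "(1 + momentum_factor) * (1 - \<beta>) * L * (\<Sum>t<T. step_size (Suc t) ^ 3 * expectation (epoch_noise (Suc t)))
      \<le> (1 + momentum_factor) * (1 - \<beta>) * L * (\<gamma> ^ 3 * grad_variance n f wstar / 2)"
  proof (rule mult_left_mono)
    have "(\<Sum>t<T. step_size (Suc t) ^ 3 * expectation (epoch_noise (Suc t)))
        \<le> (\<Sum>t<T. (\<gamma> ^ 3 * real n / real T) * (grad_variance n f wstar / (2 * real n)))"
      using gamma_pos grad_variance_nonneg step_size_pos
      by (intro sum_mono mult_mono' step_size_cube_le expectation_epoch_noise_le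
          Bochner_Integration.integral_nonneg)
        (auto simp: epoch_noise_def shuffle_noise_nonneg less_imp_le)
    also have "\<dots> = \<gamma> ^ 3 * grad_variance n f wstar / 2"
      using n_ge_1 T_ge_1 by simp
    finally show "(\<Sum>t<T. step_size (Suc t) ^ 3 * expectation (epoch_noise (Suc t)))
        \<le> \<gamma> ^ 3 * grad_variance n f wstar / 2" .
    show "0 \<le> (1 + momentum_factor) * (1 - \<beta>) * L"
      using momentum_factor beta L_pos by simp
  qed
  ultimately show ?thesis by simp
qed

text \<open>
  Every learning rate is at least the last one, and the decay is chosen such that the last one is
  \<open>\<rho>\<close> times the initial \<open>\<gamma> n\<^bsup>1/3\<^esup>/T\<^bsup>1/3\<^esup>\<close>.
\<close>

lemma sum_step_size_ge:
  "\<rho> * \<gamma> * (real n powr (1/3) * real T powr (2/3)) \<le> (\<Sum>t<T. step_size (Suc t))"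
proof -
  have "alpha_T ^ T = \<rho>"
    using rho_pos T_ge_1 by (simp add: alpha_T_def lr_alpha_def powr_power)
  then have last_step: "step_size T * real T powr (1/3) = \<gamma> * real n powr (1/3) * \<rho>"
    using T_ge_1 by (simp add: step_size_def lr_def alpha_T_def)
  have "real T * step_size T = (real T powr (2/3) * real T powr (1/3)) * step_size T"
    using T_ge_1 by (simp add: powr_add[symmetric])
  also have "\<dots> = real T powr (2/3) * (step_size T * real T powr (1/3))"
    by (simp only: mult_ac)
  also have "\<dots> = \<rho> * \<gamma> * (real n powr (1/3) * real T powr (2/3))"
    unfolding last_step by (simp only: mult_ac)
  finally have "real T * step_size T = \<rho> * \<gamma> * (real n powr (1/3) * real T powr (2/3))" .
  moreover have "real T * step_size T \<le> (\<Sum>t<T. step_size (Suc t))"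
    using sum_bounded_below[of "{..<T}" "step_size T" "\<lambda>t. step_size (Suc t)"]
    by (simp add: step_size_antimono)
  ultimately show ?thesis by simp
qed

lemma smg_gap_eq:
  assumes "\<omega> \<in> space M"
  shows "smg_gap f wstar n T \<beta> \<gamma> \<rho> w0 \<pi> \<tau> \<omega>
    = (\<Sum>t<T. indicator {Suc t} (\<tau> \<omega>) * iterate_gap t \<omega>)"
proof -
  have "\<tau> \<omega> \<in> {1..T}" using measurable_space[OF index_measurable assms] by simp
  then obtain k where k: "\<tau> \<omega> = Suc k" "k < T" by (cases "\<tau> \<omega>") auto
  have "(\<Sum>t<T. indicator {Suc t} (\<tau> \<omega>) * iterate_gap t \<omega>)
      = (\<Sum>t<T. if t = k then iterate_gap t \<omega> else 0)"
    by (intro sum.cong) (auto simp: k indicator_def)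
  also have "\<dots> = iterate_gap k \<omega>" using k by simp
  finally show ?thesis
    by (simp add: smg_gap_def smg_output_def iterate_gap_def opt.gap_def step_size_def k)
qed

text \<open>
  Decompose the output's gap by the value of the random index (\<open>smg_gap_eq\<close>), whose indicator
  is independent of the iterates.
\<close>

lemma smg_gap_expectation:
  "integrable M (smg_gap f wstar n T \<beta> \<gamma> \<rho> w0 \<pi> \<tau>)"
  "expectation (smg_gap f wstar n T \<beta> \<gamma> \<rho> w0 \<pi> \<tau>)
     = (\<Sum>t<T. step_size (Suc t) * expectation (iterate_gap t)) / (\<Sum>t<T. step_size (Suc t))"
proof -
  let ?I = "\<lambda>t \<omega>. indicator {Suc t} (\<tau> \<omega>) :: real"
  have I_meas: "random_variable borel (?I t)" for t
    by (rule measurable_compose[OF index_measurable]) simp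
  have I: "integrable M (?I t)" for t
    by (rule integrable_const_bound[where B = 1]) (use I_meas in auto)
  have EI: "expectation (?I t) = step_size (Suc t) / (\<Sum>t<T. step_size (Suc t))" if "t < T" for t
  proof -
    have "{\<omega> \<in> space M. \<tau> \<omega> = Suc t} = ?I t -` {1} \<inter> space M"
      by (auto simp: indicator_def split: if_splits)
    also have "\<dots> \<in> events" using I_meas by (rule measurable_sets) simp
    finally have event: "{\<omega> \<in> space M. \<tau> \<omega> = Suc t} \<in> events" .
    have "expectation (?I t) = expectation (indicator {\<omega> \<in> space M. \<tau> \<omega> = Suc t})"
      by (rule Bochner_Integration.integral_cong) (auto simp: indicator_def)
    also have "\<dots> = prob {\<omega> \<in> space M. \<tau> \<omega> = Suc t}"
      using event by simp
    finally show ?thesis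
      using index_prob[of "Suc t"] that
      by (simp add: step_size_def sum.atLeast1_atMost_eq)
  qed
  have prod: "integrable M (\<lambda>\<omega>. ?I t \<omega> * iterate_gap t \<omega>)"
    "expectation (\<lambda>\<omega>. ?I t \<omega> * iterate_gap t \<omega>) = expectation (?I t) * expectation (iterate_gap t)"
    if "t < T" for t
    using indep_var_integrable[OF index_gap_indep I iterate_gap_integrable]
      indep_var_lebesgue_integral[OF index_gap_indep I iterate_gap_integrable] that by auto
  have sum_int: "integrable M (\<lambda>\<omega>. \<Sum>t<T. ?I t \<omega> * iterate_gap t \<omega>)"
    by (intro Bochner_Integration.integrable_sum prod) simp
  then show "integrable M (smg_gap f wstar n T \<beta> \<gamma> \<rho> w0 \<pi> \<tau>)"
    by (subst Bochner_Integration.integrable_cong[OF refl smg_gap_eq])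
  have "expectation (smg_gap f wstar n T \<beta> \<gamma> \<rho> w0 \<pi> \<tau>)
      = expectation (\<lambda>\<omega>. \<Sum>t<T. ?I t \<omega> * iterate_gap t \<omega>)"
    by (rule Bochner_Integration.integral_cong[OF refl smg_gap_eq])
  also have "\<dots> = (\<Sum>t<T. expectation (?I t) * expectation (iterate_gap t))"
    by (subst Bochner_Integration.integral_sum) (auto simp: prod)
  also have "\<dots> = (\<Sum>t<T. step_size (Suc t) * expectation (iterate_gap t)) / (\<Sum>t<T. step_size (Suc t))"
    unfolding sum_divide_distrib by (rule sum.cong) (simp_all add: EI)
  finally show "expectation (smg_gap f wstar n T \<beta> \<gamma> \<rho> w0 \<pi> \<tau>)
     = (\<Sum>t<T. step_size (Suc t) * expectation (iterate_gap t)) / (\<Sum>t<T. step_size (Suc t))" .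
qed

text \<open>
  Taking expectations in the pathwise bound and dividing by \<open>1 - q\<close>. The initial distance comes
  with \<open>c(1 - q)\<close> in the denominator, which is at least \<open>1 - \<beta>\<close>; the noise comes with
  \<open>(1 - \<beta>)/(1 - q)\<close>, which is at most 1.
\<close>

lemma expected_weighted_gap_le:
  defines "A \<equiv> expectation (\<lambda>\<omega>. (norm (w0 \<omega> - wstar))\<^sup>2)" and "S \<equiv> grad_variance n f wstar"
  shows "(\<Sum>t<T. step_size (Suc t) * expectation (iterate_gap t))
    \<le> A / (2 * (1 - \<beta>)) + 4 * L * S * (1 + momentum_factor) * \<gamma> ^ 3 / (6 * (1 - \<beta>))"
proof -
  let ?q = momentum_factor
  let ?c = "1 - \<beta> + ?q"
  let ?R = "\<Sum>t<T. step_size (Suc t) * expectation (iterate_gap t)"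
  have q: "0 \<le> ?q" "?q \<le> \<beta>" "?q < 1" by (fact momentum_factor)+
  have A: "0 \<le> A" by (simp add: A_def)
  have P: "0 \<le> (1 + ?q) * L * \<gamma> ^ 3 * S"
    using q L_pos gamma_pos grad_variance_nonneg by (simp add: S_def)
  have "(1 - ?q) * ?R
      = expectation (\<lambda>\<omega>. (1 - ?q) * (\<Sum>t<T. step_size (Suc t) * iterate_gap t \<omega>))"
    by (simp add: Bochner_Integration.integral_sum iterate_gap_integrable)
  also have "\<dots> \<le> expectation regret_bound"
    by (intro integral_mono weighted_gap_le regret_bound_integrable integrable_mult_right
        Bochner_Integration.integrable_sum iterate_gap_integrable) simp_all
  also have "\<dots> \<le> A / (2 * ?c) + (1 + ?q) * (1 - \<beta>) * L * (\<gamma> ^ 3 * S / 2)"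
    unfolding A_def S_def by (rule expectation_regret_bound_le)
  also have "\<dots> \<le> (1 - ?q) * (A / (2 * (1 - \<beta>)) + 4 * L * S * (1 + ?q) * \<gamma> ^ 3 / (6 * (1 - \<beta>)))"
  proof -
    have "1 - \<beta> \<le> ?c * (1 - ?q)"
    proof -
      have "?c * (1 - ?q) - (1 - \<beta>) = ?q * (\<beta> - ?q)" by (simp add: algebra_simps)
      also have "0 \<le> \<dots>" using q by simp
      finally show ?thesis by simp
    qed
    then have "A * (1 - \<beta>) \<le> A * (?c * (1 - ?q))" using A by (rule mult_left_mono)
    then have "A / (2 * ?c) \<le> (1 - ?q) * (A / (2 * (1 - \<beta>)))"
      using beta q by (simp add: field_simps)
    moreover have "(1 + ?q) * (1 - \<beta>) * L * (\<gamma> ^ 3 * S / 2)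
        \<le> (1 - ?q) * (4 * L * S * (1 + ?q) * \<gamma> ^ 3 / (6 * (1 - \<beta>)))"
    proof -
      have "(1 - \<beta>) / 2 \<le> 2 / 3 * ((1 - ?q) / (1 - \<beta>))"
      proof -
        have "1 \<le> (1 - ?q) / (1 - \<beta>)" using q beta by simp
        moreover have "(1 - \<beta>) / 2 \<le> 1 / 2" using beta by simp
        ultimately show ?thesis by linarith
      qed
      from mult_left_mono[OF this P]
      have "(1 + ?q) * L * \<gamma> ^ 3 * S * ((1 - \<beta>) / 2)
          \<le> (1 + ?q) * L * \<gamma> ^ 3 * S * (2 / 3 * ((1 - ?q) / (1 - \<beta>)))" .
      moreover have "(1 + ?q) * L * \<gamma> ^ 3 * S * (2 / 3 * ((1 - ?q) / d))
          = (1 - ?q) * (4 * L * S * (1 + ?q) * \<gamma> ^ 3 / (6 * d))" for d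
        by (cases "d = 0") (simp_all add: field_simps)
      ultimately show ?thesis by (simp only: mult_ac times_divide_eq_right)
    qed
    ultimately show ?thesis by (simp only: distrib_left add_mono)
  qed
  finally show ?thesis using q by (simp only: mult_le_cancel_left_pos diff_gt_0_iff_gt)
qed

lemma expected_gap_le:
  "expectation (smg_gap f wstar n T \<beta> \<gamma> \<rho> w0 \<pi> \<tau>)
     \<le> 1 / (real n powr (1/3) * real T powr (2/3)) *
        (expectation (\<lambda>\<omega>. (norm (w0 \<omega> - wstar))\<^sup>2) / (2 * (1 - \<beta>) * \<gamma> * \<rho>)
         + 4 * L * grad_variance n f wstar * (1 + lr_alpha \<rho> T * \<beta>) * \<gamma>\<^sup>2 / (6 * (1 - \<beta>) * \<rho>))"
proof -
  define A where "A = expectation (\<lambda>\<omega>. (norm (w0 \<omega> - wstar))\<^sup>2)"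
  define S where "S = grad_variance n f wstar"
  define q where "q = momentum_factor"
  define r where "r = real n powr (1/3) * real T powr (2/3)"
  let ?B = "A / (2 * (1 - \<beta>)) + 4 * L * S * (1 + q) * \<gamma> ^ 3 / (6 * (1 - \<beta>))"
  have r: "0 < r" using n_ge_1 T_ge_1 by (simp add: r_def)
  have B: "0 \<le> ?B"
    using beta L_pos gamma_pos grad_variance_nonneg momentum_factor
    by (auto simp: A_def S_def q_def intro!: add_nonneg_nonneg divide_nonneg_nonneg mult_nonneg_nonneg)
  have "expectation (smg_gap f wstar n T \<beta> \<gamma> \<rho> w0 \<pi> \<tau>) \<le> ?B / (\<Sum>t<T. step_size (Suc t))"
    unfolding smg_gap_expectation(2) A_def S_def q_def
    by (intro divide_right_mono expected_weighted_gap_le sum_nonneg less_imp_le[OF step_size_pos])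
  also have "\<dots> \<le> ?B / (\<rho> * \<gamma> * r)"
  proof (rule divide_left_mono[OF _ B])
    show weight: "\<rho> * \<gamma> * r \<le> (\<Sum>t<T. step_size (Suc t))"
      unfolding r_def by (rule sum_step_size_ge)
    have "0 < \<rho> * \<gamma> * r" using rho_pos gamma_pos r by simp
    with weight show "0 < (\<Sum>t<T. step_size (Suc t)) * (\<rho> * \<gamma> * r)"
      using less_le_trans mult_pos_pos by blast
  qed
  also have "\<dots> = 1 / r * (A / (2 * (1 - \<beta>) * \<gamma> * \<rho>) + 4 * L * S * (1 + q) * \<gamma>\<^sup>2 / (6 * (1 - \<beta>) * \<rho>))"
  proof -
    have "(A / (2 * d) + X * \<gamma> ^ 3 / (6 * d)) / (\<rho> * \<gamma> * r)
        = 1 / r * (A / (2 * d * \<gamma> * \<rho>) + X * \<gamma>\<^sup>2 / (6 * d * \<rho>))" for d X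
      using r rho_pos gamma_pos
      by (cases "d = 0") (simp_all add: field_simps power2_eq_square power3_eq_cube)
    then show ?thesis .
  qed
  finally show ?thesis
    by (simp only: A_def S_def q_def r_def momentum_factor_def alpha_T_def)
qed

end

theorem corollary2:
  fixes L \<beta> \<gamma> \<rho> :: real
  shows
    "(\<forall>(M :: 's measure) (f :: nat \<Rightarrow> real^'d \<Rightarrow> real) wstar n T w0 \<pi> \<tau>.
        smg_rr M f wstar n T L \<beta> \<gamma> \<rho> w0 \<pi> \<tau> \<longrightarrow>
        integrable M (smg_gap f wstar n T \<beta> \<gamma> \<rho> w0 \<pi> \<tau>) \<and>
        prob_space.expectation M (smg_gap f wstar n T \<beta> \<gamma> \<rho> w0 \<pi> \<tau>)
          \<le> 1 / (real n powr (1/3) * real T powr (2/3)) *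
             (prob_space.expectation M (\<lambda>\<omega>. (norm (w0 \<omega> - wstar))\<^sup>2)
                / (2 * (1 - \<beta>) * \<gamma> * \<rho>)
              + 4 * L * grad_variance n f wstar * (1 + lr_alpha \<rho> T * \<beta>) * \<gamma>\<^sup>2
                / (6 * (1 - \<beta>) * \<rho>)))
     \<and>
     (\<forall>S D. \<exists>C. \<forall>(M :: 's measure) (f :: nat \<Rightarrow> real^'d \<Rightarrow> real) wstar n T w0 \<pi> \<tau>.
        smg_rr M f wstar n T L \<beta> \<gamma> \<rho> w0 \<pi> \<tau> \<longrightarrow>
        grad_variance n f wstar \<le> S \<longrightarrow>
        prob_space.expectation M (\<lambda>\<omega>. (norm (w0 \<omega> - wstar))\<^sup>2) \<le> D \<longrightarrow>
        prob_space.expectation M (smg_gap f wstar n T \<beta> \<gamma> \<rho> w0 \<pi> \<tau>)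
          \<le> C / (real n powr (1/3) * real T powr (2/3)))"
proof (intro conjI allI impI)
  fix M :: "'s measure" and f :: "nat \<Rightarrow> real^'d \<Rightarrow> real" and wstar n T w0 \<pi> \<tau>
  assume "smg_rr M f wstar n T L \<beta> \<gamma> \<rho> w0 \<pi> \<tau>"
  then interpret smg_rr M f wstar n T L \<beta> \<gamma> \<rho> w0 \<pi> \<tau> .
  show "integrable M (smg_gap f wstar n T \<beta> \<gamma> \<rho> w0 \<pi> \<tau>)" by (fact smg_gap_expectation(1))
  show "expectation (smg_gap f wstar n T \<beta> \<gamma> \<rho> w0 \<pi> \<tau>)
      \<le> 1 / (real n powr (1/3) * real T powr (2/3)) *
        (expectation (\<lambda>\<omega>. (norm (w0 \<omega> - wstar))\<^sup>2) / (2 * (1 - \<beta>) * \<gamma> * \<rho>)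
         + 4 * L * grad_variance n f wstar * (1 + lr_alpha \<rho> T * \<beta>) * \<gamma>\<^sup>2 / (6 * (1 - \<beta>) * \<rho>))"
    by (fact expected_gap_le)
next
  fix S D :: real
  \<comment> \<open>The decay \<open>lr_alpha \<rho> T\<close> varies with \<open>T\<close>; bounding \<open>1 + lr_alpha \<rho> T * \<beta>\<close> by 2 makes \<open>C\<close> uniform.\<close>
  define C where "C = D / (2 * (1 - \<beta>) * \<gamma> * \<rho>) + 4 * L * S * 2 * \<gamma>\<^sup>2 / (6 * (1 - \<beta>) * \<rho>)"
  have "prob_space.expectation M (smg_gap f wstar n T \<beta> \<gamma> \<rho> w0 \<pi> \<tau>)
      \<le> C / (real n powr (1/3) * real T powr (2/3))"
    if rr: "smg_rr M f wstar n T L \<beta> \<gamma> \<rho> w0 \<pi> \<tau>"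
      and S: "grad_variance n f wstar \<le> S"
      and D: "prob_space.expectation M (\<lambda>\<omega>. (norm (w0 \<omega> - wstar))\<^sup>2) \<le> D"
    for M :: "'s measure" and f :: "nat \<Rightarrow> real^'d \<Rightarrow> real" and wstar n T w0 \<pi> \<tau>
  proof -
    interpret smg_rr M f wstar n T L \<beta> \<gamma> \<rho> w0 \<pi> \<tau> by (fact rr)
    let ?q = "lr_alpha \<rho> T * \<beta>"
    have q: "0 \<le> ?q" "?q \<le> 1"
      using momentum_factor by (simp_all add: momentum_factor_def alpha_T_def)
    have "grad_variance n f wstar * (1 + ?q) \<le> S * 2"
      using S q grad_variance_nonneg by (intro mult_mono) auto
    then have "(4 * L * \<gamma>\<^sup>2) * (grad_variance n f wstar * (1 + ?q)) \<le> (4 * L * \<gamma>\<^sup>2) * (S * 2)"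
      using L_pos by (intro mult_left_mono) auto
    then have "4 * L * grad_variance n f wstar * (1 + ?q) * \<gamma>\<^sup>2 \<le> 4 * L * S * 2 * \<gamma>\<^sup>2"
      by (simp only: mult_ac)
    then have "expectation (\<lambda>\<omega>. (norm (w0 \<omega> - wstar))\<^sup>2) / (2 * (1 - \<beta>) * \<gamma> * \<rho>)
        + 4 * L * grad_variance n f wstar * (1 + ?q) * \<gamma>\<^sup>2 / (6 * (1 - \<beta>) * \<rho>) \<le> C"
      unfolding C_def using D beta gamma_pos rho_pos
      by (intro add_mono divide_right_mono) auto
    from mult_left_mono[OF this, of "1 / (real n powr (1/3) * real T powr (2/3))"]
    have "1 / (real n powr (1/3) * real T powr (2/3)) *
        (expectation (\<lambda>\<omega>. (norm (w0 \<omega> - wstar))\<^sup>2) / (2 * (1 - \<beta>) * \<gamma> * \<rho>)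
        + 4 * L * grad_variance n f wstar * (1 + ?q) * \<gamma>\<^sup>2 / (6 * (1 - \<beta>) * \<rho>))
        \<le> C / (real n powr (1/3) * real T powr (2/3))"
      by simp
    with expected_gap_le show ?thesis by (rule order_trans)
  qed
  then show "\<exists>C. \<forall>(M :: 's measure) (f :: nat \<Rightarrow> real^'d \<Rightarrow> real) wstar n T w0 \<pi> \<tau>.
      smg_rr M f wstar n T L \<beta> \<gamma> \<rho> w0 \<pi> \<tau> \<longrightarrow>
      grad_variance n f wstar \<le> S \<longrightarrow>
      prob_space.expectation M (\<lambda>\<omega>. (norm (w0 \<omega> - wstar))\<^sup>2) \<le> D \<longrightarrow>
      prob_space.expectation M (smg_gap f wstar n T \<beta> \<gamma> \<rho> w0 \<pi> \<tau>)
        \<le> C / (real n powr (1/3) * real T powr (2/3))"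
    by blast
qed

end
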